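(* Let $(\rho,v)$ be an equivariant representation of $\Sigma$ on a Hilbert $A$-module $X$. Then there exists a unitary $W\in\mathcal L(X\otimes_{\ell_\Sigma}A^\Sigma,X^G)$ satisfying $$[W(x\dot\otimes\xi)](g)=v(g)^{-1}\big(x\cdot\xi(g)\big)\qquad(x\in X,\ \xi\in A^\Sigma,\ g\in G),$$ and for all $a\in A$, $g\in G$, $x\in X$, $\xi\in A^\Sigma$: $$\tilde\rho(a)W(x\dot\otimes\xi)=W(\rho(a)x\dot\otimes\xi),\qquad \tilde\lambda_\rho(g)W(x\dot\otimes\xi)=W\big(v(g)x\dot\otimes\lambda_\Sigma(g)\xi\big).$$ In particular, the maps $x\dot\otimes\xi\mapsto\rho(a)x\dot\otimes\xi$ and $x\dot\otimes\xi\mapsto v(g)x\dot\otimes\lambda_\Sigma(g)\xi$ extend to a covariant representation of $\Sigma$ on $X\otimes_{\ell_\Sigma}A^\Sigma$ which is unitarily equivalent (via $W$) to the regular covariant representation $(\tilde\rho,\tilde\lambda_\rho)$ on $X^G$.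
   Context: Standing setup. All C*-algebras are unital. A twisted (unital, discrete) C*-dynamical system is a quadruple $\Sigma=(A,G,\alpha,\sigma)$, where $A$ is a unital C*-algebra, $G$ a discrete group with identity $e$, $\alpha:G\to\mathrm{Aut}(A)$ and $\sigma:G\times G\to\mathcal U(A)$ satisfy $\alpha_g\alpha_h=\mathrm{Ad}(\sigma(g,h))\alpha_{gh}$, $\sigma(g,h)\sigma(gh,k)=\alpha_g(\sigma(h,k))\sigma(g,hk)$, $\sigma(g,e)=\sigma(e,g)=1$. Let $A^\Sigma$ be the set of $\xi:G\to A$ such that $\sum_g\alpha_g^{-1}(\xi(g)^*\xi(g))$ converges (unconditionally) in norm; a right Hilbert $A$-module with $(\xi\times a)(g)=\xi(g)\alpha_g(a)$, $\langle\xi,\eta\rangle_\alpha=\sum_g\alpha_g^{-1}(\xi(g)^*\eta(g))$. Let $\ell_\Sigma:A\to\mathcal L(A^\Sigma)$, $(\ell_\Sigma(a)\xi)(h)=a\xi(h)$, and $(\lambda_\Sigma(g)\xi)(h)=\alpha_g(\xi(g^{-1}h))\sigma(g,g^{-1}h)$. Hilbert modules are right modules with inner products linear in the second variable. $X\otimes_{\ell_\Sigma}A^\Sigma$ denotes the internal tensor product of the Hilbert $A$-module $X$ with $A^\Sigma$ via $\ell_\Sigma$ (a Hilbert $A$-module with $\langle x\dot\otimes\xi,y\dot\otimes\eta\rangle=\langle\xi,\ell_\Sigma(\langle x,y\rangle)\eta\rangle_\alpha$). For a Hilbert $A$-module $X$, $X^G$ is the set of $\xi:G\to X$ with $\sum_g\langle\xi(g),\xi(g)\rangle$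 norm convergent, a Hilbert $A$-module with $\langle\xi,\eta\rangle=\sum_g\langle\xi(g),\eta(g)\rangle$ and $(\xi\cdot a)(g)=\xi(g)\cdot a$. Given a representation $\rho$ of $A$ on $X$, the regular covariant representation on $X^G$ is $(\tilde\rho(a)\xi)(h)=\rho(\alpha_h^{-1}(a))\xi(h)$, $(\tilde\lambda_\rho(g)\xi)(h)=\rho(\alpha_h^{-1}(\sigma(g,g^{-1}h)))\xi(g^{-1}h)$. Equivariant representations: an equivariant representation of $\Sigma$ on a Hilbert $A$-module $X$ is a pair $(\rho,v)$ where $\rho:A\to\mathcal L(X)$ is a unital *-homomorphism and $v$ maps $G$ into the group of $\mathbb C$-linear bounded invertible maps $X\to X$, such that for all $g,h\in G$, $a\in A$, $x,x'\in X$: (i) $\rho(\alpha_g(a))=v(g)\rho(a)v(g)^{-1}$; (ii) $v(g)v(h)=\mathrm{ad}_\rho(\sigma(g,h))v(gh)$, where $\mathrm{ad}_\rho(u)x=(\rho(u)x)\cdot u^*$; (iii) $\alpha_g(\langle x,x'\rangle)=\langle v(g)x,v(g)x'\rangle$; (iv) $v(g)(x\cdot a)=(v(g)x)\cdot\alpha_g(a)$. *)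

theory Defs
  imports "HOL-Analysis.Analysis" "HOL-Library.Function_Algebras"
begin

text \<open>A unital C*-algebra is modelled as a real Banach algebra with unit (type class),
  together with an explicit complex scalar multiplication sc extending the real one and an
  involution st, satisfying the C*-identity. The algebra is the whole type.\<close>

definition cstar_alg :: "(complex \<Rightarrow> 'a::{real_normed_algebra_1,banach} \<Rightarrow> 'a) \<Rightarrow> ('a \<Rightarrow> 'a) \<Rightarrow> bool" where
  "cstar_alg sc st \<longleftrightarrow>
     (\<forall>r a. sc (complex_of_real r) a = scaleR r a) \<and>
     (\<forall>c d a. sc (c + d) a = sc c a + sc d a) \<and>
     (\<forall>c a b. sc c (a + b) = sc c a + sc c b) \<and>
     (\<forall>c d a. sc c (sc d a) = sc (c * d) a) \<and>
     (\<forall>c a b. sc c a * b = sc c (a * b) \<and> a * sc c b = sc c (a * b)) \<and>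
     (\<forall>c a. norm (sc c a) = cmod c * norm a) \<and>
     (\<forall>a b. st (a + b) = st a + st b) \<and>
     (\<forall>c a. st (sc c a) = sc (cnj c) (st a)) \<and>
     (\<forall>a b. st (a * b) = st b * st a) \<and>
     (\<forall>a. st (st a) = a) \<and>
     (\<forall>a. norm (st a * a) = (norm a)\<^sup>2)"

definition positive_el :: "('a::times \<Rightarrow> 'a) \<Rightarrow> 'a \<Rightarrow> bool" where
  "positive_el st a \<longleftrightarrow> (\<exists>b. a = st b * b)"

definition unitary_el :: "('a::monoid_mult \<Rightarrow> 'a) \<Rightarrow> 'a \<Rightarrow> bool" where
  "unitary_el st u \<longleftrightarrow> st u * u = 1 \<and> u * st u = 1"

definition star_aut :: "(complex \<Rightarrow> 'a::{real_normed_algebra_1,banach} \<Rightarrow> 'a) \<Rightarrow> ('a \<Rightarrow> 'a) \<Rightarrow> ('a \<Rightarrow> 'a) \<Rightarrow> bool" where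
  "star_aut sc st f \<longleftrightarrow> bij f \<and>
     (\<forall>a b. f (a + b) = f a + f b) \<and> (\<forall>c a. f (sc c a) = sc c (f a)) \<and>
     (\<forall>a b. f (a * b) = f a * f b) \<and> (\<forall>a. f (st a) = st (f a))"

text \<open>The discrete group G is a type of class group_add, written additively:
  identity 0, product g h = g + h, inverse g^-1 = - g (not assumed commutative).\<close>

definition twisted_system ::
  "(complex \<Rightarrow> 'a::{real_normed_algebra_1,banach} \<Rightarrow> 'a) \<Rightarrow> ('a \<Rightarrow> 'a) \<Rightarrow>
   ('g::group_add \<Rightarrow> 'a \<Rightarrow> 'a) \<Rightarrow> ('g \<Rightarrow> 'g \<Rightarrow> 'a) \<Rightarrow> bool" where
  "twisted_system sc st \<alpha> \<sigma> \<longleftrightarrow> cstar_alg sc st \<and>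
     (\<forall>g. star_aut sc st (\<alpha> g)) \<and>
     (\<forall>g h. unitary_el st (\<sigma> g h)) \<and>
     (\<forall>g h a. \<alpha> g (\<alpha> h a) = \<sigma> g h * \<alpha> (g + h) a * st (\<sigma> g h)) \<and>
     (\<forall>g h k. \<sigma> g h * \<sigma> (g + h) k = \<alpha> g (\<sigma> h k) * \<sigma> g (h + k)) \<and>
     (\<forall>g. \<sigma> g 0 = 1 \<and> \<sigma> 0 g = 1)"

record ('x, 'a) hmod =
  hcar :: "'x set"
  hsc  :: "complex \<Rightarrow> 'x \<Rightarrow> 'x"
  hact :: "'x \<Rightarrow> 'a \<Rightarrow> 'x"
  hip  :: "'x \<Rightarrow> 'x \<Rightarrow> 'a"

definition hnorm :: "('x, 'a::real_normed_vector) hmod \<Rightarrow> 'x \<Rightarrow> real" where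
  "hnorm X x = sqrt (norm (hip X x x))"

definition is_hmod ::
  "(complex \<Rightarrow> 'a::{real_normed_algebra_1,banach} \<Rightarrow> 'a) \<Rightarrow> ('a \<Rightarrow> 'a) \<Rightarrow>
   ('x::ab_group_add, 'a) hmod \<Rightarrow> bool" where
  "is_hmod sc st X \<longleftrightarrow>
     0 \<in> hcar X \<and>
     (\<forall>x\<in>hcar X. \<forall>y\<in>hcar X. x + y \<in> hcar X \<and> - x \<in> hcar X) \<and>
     (\<forall>x\<in>hcar X. \<forall>c a. hsc X c x \<in> hcar X \<and> hact X x a \<in> hcar X) \<and>
     (\<forall>x\<in>hcar X. \<forall>y\<in>hcar X. \<forall>c. hsc X c (x + y) = hsc X c x + hsc X c y) \<and>
     (\<forall>x\<in>hcar X. \<forall>c d. hsc X (c + d) x = hsc X c x + hsc X d x \<and>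
                        hsc X c (hsc X d x) = hsc X (c * d) x) \<and>
     (\<forall>x\<in>hcar X. hsc X 1 x = x) \<and>
     (\<forall>x\<in>hcar X. \<forall>y\<in>hcar X. \<forall>a. hact X (x + y) a = hact X x a + hact X y a) \<and>
     (\<forall>x\<in>hcar X. \<forall>a b. hact X x (a + b) = hact X x a + hact X x b \<and>
                        hact X x (a * b) = hact X (hact X x a) b) \<and>
     (\<forall>x\<in>hcar X. hact X x 1 = x) \<and>
     (\<forall>x\<in>hcar X. \<forall>c a. hact X (hsc X c x) a = hsc X c (hact X x a) \<and>
                        hact X x (sc c a) = hsc X c (hact X x a)) \<and>
     (\<forall>x\<in>hcar X. \<forall>y\<in>hcar X. \<forall>z\<in>hcar X. hip X x (y + z) = hip X x y + hip X x z) \<and>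
     (\<forall>x\<in>hcar X. \<forall>y\<in>hcar X. \<forall>c a. hip X x (hsc X c y) = sc c (hip X x y) \<and>
                                     hip X x (hact X y a) = hip X x y * a) \<and>
     (\<forall>x\<in>hcar X. \<forall>y\<in>hcar X. hip X y x = st (hip X x y)) \<and>
     (\<forall>x\<in>hcar X. positive_el st (hip X x x)) \<and>
     (\<forall>x\<in>hcar X. hip X x x = 0 \<longrightarrow> x = 0) \<and>
     (\<forall>s. (\<forall>n. s n \<in> hcar X) \<longrightarrow>
          (\<forall>e>0. \<exists>N::nat. \<forall>m\<ge>N. \<forall>n\<ge>N. hnorm X (s m - s n) < e) \<longrightarrow>
          (\<exists>l\<in>hcar X. \<forall>e>0. \<exists>N::nat. \<forall>n\<ge>N. hnorm X (s n - l) < e))"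

definition adjointable :: "('x, 'a) hmod \<Rightarrow> ('y, 'a) hmod \<Rightarrow> ('x \<Rightarrow> 'y) \<Rightarrow> bool" where
  "adjointable X Y T \<longleftrightarrow> (\<forall>x\<in>hcar X. T x \<in> hcar Y) \<and>
     (\<exists>S. (\<forall>y\<in>hcar Y. S y \<in> hcar X) \<and>
          (\<forall>x\<in>hcar X. \<forall>y\<in>hcar Y. hip Y (T x) y = hip X x (S y)))"

definition unitary_op :: "('x, 'a) hmod \<Rightarrow> ('y, 'a) hmod \<Rightarrow> ('x \<Rightarrow> 'y) \<Rightarrow> bool" where
  "unitary_op X Y T \<longleftrightarrow> (\<forall>x\<in>hcar X. T x \<in> hcar Y) \<and>
     (\<exists>S. (\<forall>y\<in>hcar Y. S y \<in> hcar X) \<and>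
          (\<forall>x\<in>hcar X. \<forall>y\<in>hcar Y. hip Y (T x) y = hip X x (S y)) \<and>
          (\<forall>x\<in>hcar X. S (T x) = x) \<and> (\<forall>y\<in>hcar Y. T (S y) = y))"

definition star_rep ::
  "(complex \<Rightarrow> 'a::{real_normed_algebra_1,banach} \<Rightarrow> 'a) \<Rightarrow> ('a \<Rightarrow> 'a) \<Rightarrow>
   ('x, 'a) hmod \<Rightarrow> ('a \<Rightarrow> 'x \<Rightarrow> 'x::ab_group_add) \<Rightarrow> bool" where
  "star_rep sc st X \<rho> \<longleftrightarrow>
     (\<forall>a. \<forall>x\<in>hcar X. \<rho> a x \<in> hcar X) \<and>
     (\<forall>a. \<forall>x\<in>hcar X. \<forall>y\<in>hcar X. hip X (\<rho> a x) y = hip X x (\<rho> (st a) y)) \<and>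
     (\<forall>a b. \<forall>x\<in>hcar X. \<rho> (a + b) x = \<rho> a x + \<rho> b x) \<and>
     (\<forall>c a. \<forall>x\<in>hcar X. \<rho> (sc c a) x = hsc X c (\<rho> a x)) \<and>
     (\<forall>a b. \<forall>x\<in>hcar X. \<rho> (a * b) x = \<rho> a (\<rho> b x)) \<and>
     (\<forall>x\<in>hcar X. \<rho> 1 x = x)"

definition bounded_invertible_map ::
  "(complex \<Rightarrow> 'a::{real_normed_algebra_1,banach} \<Rightarrow> 'a) \<Rightarrow> ('x::ab_group_add, 'a) hmod \<Rightarrow> ('x \<Rightarrow> 'x) \<Rightarrow> bool" where
  "bounded_invertible_map sc X f \<longleftrightarrow>
     bij_betw f (hcar X) (hcar X) \<and>
     (\<forall>x\<in>hcar X. \<forall>y\<in>hcar X. f (x + y) = f x + f y) \<and>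
     (\<forall>c. \<forall>x\<in>hcar X. f (hsc X c x) = hsc X c (f x)) \<and>
     (\<exists>K. \<forall>x\<in>hcar X. hnorm X (f x) \<le> K * hnorm X x) \<and>
     (\<exists>K. \<forall>x\<in>hcar X. hnorm X (inv_into (hcar X) f x) \<le> K * hnorm X x)"

definition ad_rep :: "('x, 'a) hmod \<Rightarrow> ('a \<Rightarrow> 'x \<Rightarrow> 'x) \<Rightarrow> ('a \<Rightarrow> 'a) \<Rightarrow> 'a \<Rightarrow> 'x \<Rightarrow> 'x" where
  "ad_rep X \<rho> st u x = hact X (\<rho> u x) (st u)"

definition equivariant_rep ::
  "(complex \<Rightarrow> 'a::{real_normed_algebra_1,banach} \<Rightarrow> 'a) \<Rightarrow> ('a \<Rightarrow> 'a) \<Rightarrow>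
   ('g::group_add \<Rightarrow> 'a \<Rightarrow> 'a) \<Rightarrow> ('g \<Rightarrow> 'g \<Rightarrow> 'a) \<Rightarrow>
   ('x::ab_group_add, 'a) hmod \<Rightarrow> ('a \<Rightarrow> 'x \<Rightarrow> 'x) \<Rightarrow> ('g \<Rightarrow> 'x \<Rightarrow> 'x) \<Rightarrow> bool" where
  "equivariant_rep sc st \<alpha> \<sigma> X \<rho> v \<longleftrightarrow>
     star_rep sc st X \<rho> \<and>
     (\<forall>g. bounded_invertible_map sc X (v g)) \<and>
     (\<forall>g a. \<forall>x\<in>hcar X. \<rho> (\<alpha> g a) x = v g (\<rho> a (inv_into (hcar X) (v g) x))) \<and>
     (\<forall>g h. \<forall>x\<in>hcar X. v g (v h x) = ad_rep X \<rho> st (\<sigma> g h) (v (g + h) x)) \<and>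
     (\<forall>g. \<forall>x\<in>hcar X. \<forall>x'\<in>hcar X. \<alpha> g (hip X x x') = hip X (v g x) (v g x')) \<and>
     (\<forall>g a. \<forall>x\<in>hcar X. v g (hact X x a) = hact X (v g x) (\<alpha> g a))"

definition ASigma ::
  "(complex \<Rightarrow> 'a::{real_normed_algebra_1,banach} \<Rightarrow> 'a) \<Rightarrow> ('a \<Rightarrow> 'a) \<Rightarrow>
   ('g::group_add \<Rightarrow> 'a \<Rightarrow> 'a) \<Rightarrow> ('g \<Rightarrow> 'a, 'a) hmod" where
  "ASigma sc st \<alpha> =
     \<lparr> hcar = {\<xi>. (\<lambda>g. inv (\<alpha> g) (st (\<xi> g) * \<xi> g)) summable_on UNIV},
       hsc = (\<lambda>c \<xi> g. sc c (\<xi> g)),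
       hact = (\<lambda>\<xi> a g. \<xi> g * \<alpha> g a),
       hip = (\<lambda>\<xi> \<eta>. \<Sum>\<^sub>\<infinity>g. inv (\<alpha> g) (st (\<xi> g) * \<eta> g)) \<rparr>"

definition ellSigma :: "'a::times \<Rightarrow> ('g \<Rightarrow> 'a) \<Rightarrow> ('g \<Rightarrow> 'a)" where
  "ellSigma a \<xi> = (\<lambda>h. a * \<xi> h)"

definition lambdaSigma ::
  "('g::group_add \<Rightarrow> 'a::times \<Rightarrow> 'a) \<Rightarrow> ('g \<Rightarrow> 'g \<Rightarrow> 'a) \<Rightarrow> 'g \<Rightarrow> ('g \<Rightarrow> 'a) \<Rightarrow> ('g \<Rightarrow> 'a)" where
  "lambdaSigma \<alpha> \<sigma> g \<xi> = (\<lambda>h. \<alpha> g (\<xi> (- g + h)) * \<sigma> g (- g + h))"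

definition XG :: "('x::ab_group_add, 'a::{real_normed_algebra_1,banach}) hmod \<Rightarrow> ('g \<Rightarrow> 'x, 'a) hmod" where
  "XG X =
     \<lparr> hcar = {\<xi>. (\<forall>g. \<xi> g \<in> hcar X) \<and> (\<lambda>g. hip X (\<xi> g) (\<xi> g)) summable_on UNIV},
       hsc = (\<lambda>c \<xi> g. hsc X c (\<xi> g)),
       hact = (\<lambda>\<xi> a g. hact X (\<xi> g) a),
       hip = (\<lambda>\<xi> \<eta>. \<Sum>\<^sub>\<infinity>g. hip X (\<xi> g) (\<eta> g)) \<rparr>"

definition reg_rho :: "('g \<Rightarrow> 'a \<Rightarrow> 'a) \<Rightarrow> ('a \<Rightarrow> 'x \<Rightarrow> 'x) \<Rightarrow> 'a \<Rightarrow> ('g \<Rightarrow> 'x) \<Rightarrow> ('g \<Rightarrow> 'x)" where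
  "reg_rho \<alpha> \<rho> a \<xi> = (\<lambda>h. \<rho> (inv (\<alpha> h) a) (\<xi> h))"

definition reg_lambda ::
  "('g::group_add \<Rightarrow> 'a \<Rightarrow> 'a) \<Rightarrow> ('g \<Rightarrow> 'g \<Rightarrow> 'a) \<Rightarrow> ('a \<Rightarrow> 'x \<Rightarrow> 'x) \<Rightarrow> 'g \<Rightarrow> ('g \<Rightarrow> 'x) \<Rightarrow> ('g \<Rightarrow> 'x)" where
  "reg_lambda \<alpha> \<sigma> \<rho> g \<xi> = (\<lambda>h. \<rho> (inv (\<alpha> h) (\<sigma> g (- g + h))) (\<xi> (- g + h)))"

definition covariant_rep ::
  "(complex \<Rightarrow> 'a::{real_normed_algebra_1,banach} \<Rightarrow> 'a) \<Rightarrow> ('a \<Rightarrow> 'a) \<Rightarrow>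
   ('g::group_add \<Rightarrow> 'a \<Rightarrow> 'a) \<Rightarrow> ('g \<Rightarrow> 'g \<Rightarrow> 'a) \<Rightarrow>
   ('y::ab_group_add, 'a) hmod \<Rightarrow> ('a \<Rightarrow> 'y \<Rightarrow> 'y) \<Rightarrow> ('g \<Rightarrow> 'y \<Rightarrow> 'y) \<Rightarrow> bool" where
  "covariant_rep sc st \<alpha> \<sigma> Y \<pi> u \<longleftrightarrow>
     star_rep sc st Y \<pi> \<and>
     (\<forall>g. unitary_op Y Y (u g)) \<and>
     (\<forall>g a. \<forall>y\<in>hcar Y. u g (\<pi> a y) = \<pi> (\<alpha> g a) (u g y)) \<and>
     (\<forall>g h. \<forall>y\<in>hcar Y. u g (u h y) = \<pi> (\<sigma> g h) (u (g + h) y))"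

text \<open>Characterised (uniquely up to a unique compatible unitary) as a Hilbert A-module T with
  a map tens (x, xi) \<mapsto> x \<otimes> xi satisfying the inner product formula and whose
  elementary tensors have dense linear span.\<close>

definition internal_tensor ::
  "(complex \<Rightarrow> 'a::{real_normed_algebra_1,banach} \<Rightarrow> 'a) \<Rightarrow> ('a \<Rightarrow> 'a) \<Rightarrow>
   ('g::group_add \<Rightarrow> 'a \<Rightarrow> 'a) \<Rightarrow> ('x::ab_group_add, 'a) hmod \<Rightarrow>
   ('t::ab_group_add, 'a) hmod \<Rightarrow> ('x \<Rightarrow> ('g \<Rightarrow> 'a) \<Rightarrow> 't) \<Rightarrow> bool" where
  "internal_tensor sc st \<alpha> X T tens \<longleftrightarrow>
     is_hmod sc st T \<and>
     (\<forall>x\<in>hcar X. \<forall>\<xi>\<in>hcar (ASigma sc st \<alpha>). tens x \<xi> \<in> hcar T) \<and>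
     (\<forall>x\<in>hcar X. \<forall>\<xi>\<in>hcar (ASigma sc st \<alpha>). \<forall>y\<in>hcar X. \<forall>\<eta>\<in>hcar (ASigma sc st \<alpha>).
        hip T (tens x \<xi>) (tens y \<eta>) = hip (ASigma sc st \<alpha>) \<xi> (ellSigma (hip X x y) \<eta>)) \<and>
     (\<forall>t\<in>hcar T. \<forall>e>0. \<exists>I xs \<xi>s. finite (I::nat set) \<and> xs ` I \<subseteq> hcar X \<and>
        \<xi>s ` I \<subseteq> hcar (ASigma sc st \<alpha>) \<and>
        hnorm T (t - (\<Sum>i\<in>I. tens (xs i) (\<xi>s i))) < e)"

end

theory Submission
  imports Defs
begin

text \<open>On elementary tensors the formula for \<open>W\<close> preserves inner products term by term in \<open>g\<close>,
  because \<open>v(g)\<^sup>-\<^sup>1\<close> intertwines the inner product of \<open>X\<close> with \<open>\<alpha>\<^sub>g\<^sup>-\<^sup>1\<close>. Its range contains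
  \<open>W (v(g) x \<otimes> \<delta>\<^sub>g) = x\<close> placed at \<open>g\<close>, hence all finitely supported functions, which are dense in
  \<open>X\<^sup>G\<close>; so \<open>W\<close> extends to a unitary, and the covariant representation on the tensor product is the
  regular one carried back along \<open>W\<close>. Summability questions are settled by comparing positive
  elements, which needs the order theory of C*-algebras: sums of elements \<open>b\<^sup>* b\<close> are of this form,
  and the norm is monotone on them. This is obtained without spectral theory from square roots given
  by the power series of \<open>1 - sqrt (1 - x)\<close>, whose coefficients are nonnegative with sum at most 1,
  so that it converges absolutely for all \<open>norm x \<le> 1\<close>.\<close>

section \<open>Square roots and the positive cone of a C*-algebra\<close>

text \<open>The sums that define both modules converge unconditionally in norm but in general not
  absolutely, so bounds on the norms of single terms decide nothing. Finite partial sums have to be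
  dominated in the order of the algebra and only then estimated in norm; this is what calls for the
  order theory, and why Cauchy-Schwarz is proved in a generality that covers partial sums. The
  tensor product is known only through the inner products of elementary tensors and the density of
  their sums, so there is no concrete space on which to write \<open>W\<close> down. Instead, two
  families with equal Gram matrices, each with dense finite sums, are shown to determine a unitary;
  that it is well defined, injective and linear is read off from inner products.\<close>

fun sqrt_coeff :: "nat \<Rightarrow> real" where
  "sqrt_coeff n = (if n = 0 then 0 else if n = 1 then 1/2
     else (\<Sum>i\<in>{1..<n}. sqrt_coeff i * sqrt_coeff (n - i)) / 2)"

declare sqrt_coeff.simps [simp del]

lemma sqrt_coeff_nonneg: "sqrt_coeff n \<ge> 0"
proof (induction n rule: less_induct)
  case (less n)
  then show ?case
    by (subst sqrt_coeff.simps) (auto intro!: sum_nonneg)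
qed

lemma sqrt_coeff_0 [simp]: "sqrt_coeff 0 = 0"
  by (subst sqrt_coeff.simps) simp

lemma sqrt_coeff_1 [simp]: "sqrt_coeff (Suc 0) = 1/2"
  by (subst sqrt_coeff.simps) simp

text \<open>The coefficient form of \<open>s * s = 2 * s - x\<close> for
  \<open>s = 1 - sqrt (1 - x)\<close>. The recursion defining \<open>sqrt_coeff\<close> is this
  identity solved for the n-th coefficient; the end terms drop out because the coefficient at 0 is
  0.\<close>

lemma sqrt_coeff_convolution:
  "(\<Sum>i\<le>n. sqrt_coeff i * sqrt_coeff (n - i)) = 2 * sqrt_coeff n - (if n = 1 then 1 else 0)"
proof (cases "n \<le> 1")
  case True
  then have "n = 0 \<or> n = Suc 0" by auto
  then show ?thesis by auto
next
  case False
  have "{..n} = insert 0 (insert n {1..<n})" using False by auto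
  then have "(\<Sum>i\<le>n. sqrt_coeff i * sqrt_coeff (n - i))
    = (\<Sum>i\<in>{1..<n}. sqrt_coeff i * sqrt_coeff (n - i))"
    using False by simp
  also have "\<dots> = 2 * sqrt_coeff n"
    using False by (subst (3) sqrt_coeff.simps) simp
  finally show ?thesis using False by simp
qed

text \<open>Summing the convolution identity up to n + 1 yields
  \<open>2 * S (n + 1) - 1 \<le> (S n)^2\<close> for the partial sums S, so the bound 1 reproduces
  itself: it is the fixed point of \<open>(1 + t^2) / 2\<close>.\<close>

lemma sum_sqrt_coeff_le_1: "(\<Sum>i\<le>n. sqrt_coeff i) \<le> 1"
proof (induction n)
  case 0
  then show ?case by simp
next
  case (Suc n)
  let ?c = sqrt_coeff
  have "(\<Sum>k\<le>Suc n. \<Sum>i\<le>k. ?c i * ?c (k - i)) = (\<Sum>(i,j)\<in>{(i,j). i + j \<le> Suc n}. ?c i * ?c j)"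
    by (subst sum.triangle_reindex_eq) simp
  also have "\<dots> = (\<Sum>(i,j)\<in>{(i,j). i + j \<le> Suc n} \<inter> {..n}\<times>{..n}. ?c i * ?c j)"
  proof (rule sum.mono_neutral_right)
    show "finite {(i, j). i + j \<le> Suc n}"
      by (rule finite_subset[of _ "{..Suc n} \<times> {..Suc n}"]) auto
    \<comment> \<open>Outside the square one index equals n + 1, so the other is 0 and carries the
      coefficient 0. Hence the triangle of size n + 1 costs no more than the square of size
      n.\<close>
    have "i = 0 \<or> j = 0" if "i + j \<le> Suc n" "\<not> (i \<le> n \<and> j \<le> n)" for i j
      using that by auto
    then show "\<forall>ij\<in>{(i, j). i + j \<le> Suc n} - {(i,j). i + j \<le> Suc n} \<inter> {..n}\<times>{..n}.
        (case ij of (i, j) \<Rightarrow> ?c i * ?c j) = 0"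
      by fastforce
  qed auto
  also have "\<dots> \<le> (\<Sum>(i,j)\<in>{..n}\<times>{..n}. ?c i * ?c j)"
    by (rule sum_mono2) (auto simp: sqrt_coeff_nonneg)
  also have "\<dots> = (\<Sum>i\<le>n. ?c i) * (\<Sum>i\<le>n. ?c i)"
    by (simp add: sum_product sum.cartesian_product)
  also have "\<dots> \<le> 1"
    using Suc by (simp add: mult_le_one sum_nonneg sqrt_coeff_nonneg)
  finally have "(\<Sum>k\<le>Suc n. \<Sum>i\<le>k. ?c i * ?c (k - i)) \<le> 1" .
  moreover have "(\<Sum>k\<le>Suc n. \<Sum>i\<le>k. ?c i * ?c (k - i)) = 2 * (\<Sum>k\<le>Suc n. ?c k) - 1"
    by (subst sqrt_coeff_convolution) (simp add: sum_subtractf sum_distrib_left del: sum.atMost_Suc)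
  ultimately show ?case by simp
qed

lemma summable_sqrt_coeff: "summable sqrt_coeff"
proof (rule bounded_imp_summable[where B = 1])
  show "0 \<le> sqrt_coeff n" for n by (rule sqrt_coeff_nonneg)
  show "(\<Sum>k\<le>n. sqrt_coeff k) \<le> 1" for n by (rule sum_sqrt_coeff_le_1)
qed

lemma suminf_sqrt_coeff_le_1: "suminf sqrt_coeff \<le> 1"
proof -
  have "(\<lambda>n. \<Sum>k\<le>n. sqrt_coeff k) \<longlonglongrightarrow> suminf sqrt_coeff"
    using summable_sqrt_coeff by (rule summable_LIMSEQ')
  then show ?thesis
    by (rule LIMSEQ_le_const2) (auto simp: sum_sqrt_coeff_le_1)
qed

section \<open>The root series in a Banach algebra\<close>

definition sqrt_series :: "'a::{real_normed_algebra_1,banach} \<Rightarrow> 'a" where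
  "sqrt_series x = (\<Sum>n. sqrt_coeff n *\<^sub>R x ^ n)"

context
  fixes x :: "'a::{real_normed_algebra_1,banach}"
  assumes nx: "norm x \<le> 1"
begin

lemma norm_sqrt_series_term: "norm (sqrt_coeff n *\<^sub>R x ^ n) \<le> sqrt_coeff n"
proof -
  have "norm (x ^ n) \<le> 1"
    using norm_power_ineq[of x n] power_le_one[of "norm x" n] nx by simp
  then show ?thesis
    using sqrt_coeff_nonneg[of n] by (simp add: mult_left_le)
qed

lemma summable_norm_sqrt_series: "summable (\<lambda>n. norm (sqrt_coeff n *\<^sub>R x ^ n))"
  by (rule summable_comparison_test'[OF summable_sqrt_coeff, of 0])
     (use norm_sqrt_series_term in auto)

lemma summable_sqrt_series: "summable (\<lambda>n. sqrt_coeff n *\<^sub>R x ^ n)"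
  by (rule summable_norm_cancel) (rule summable_norm_sqrt_series)

text \<open>This bound is what puts \<open>1 - sqrt_series x\<close> into the positive cone, with
  parameter \<open>t = 1\<close>.\<close>

lemma norm_sqrt_series_le: "norm (sqrt_series x) \<le> 1"
proof -
  have "norm (sqrt_series x) \<le> (\<Sum>n. norm (sqrt_coeff n *\<^sub>R x ^ n))"
    unfolding sqrt_series_def by (rule summable_norm) (rule summable_norm_sqrt_series)
  also have "\<dots> \<le> suminf sqrt_coeff"
    by (rule suminf_le) (use norm_sqrt_series_term summable_norm_sqrt_series summable_sqrt_coeff in auto)
  finally show ?thesis using suminf_sqrt_coeff_le_1 by simp
qed

text \<open>Rearranged, \<open>1 - sqrt_series x\<close> squares to \<open>1 - x\<close>. Absolute
  convergence permits the Cauchy product, whose coefficients are given by the convolution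
  identity.\<close>

lemma sqrt_series_square: "sqrt_series x * sqrt_series x = 2 *\<^sub>R sqrt_series x - x"
proof -
  let ?f = "\<lambda>n. sqrt_coeff n *\<^sub>R x ^ n"
  have sx: "(\<lambda>n. if n = 1 then x else 0) sums x"
    using sums_single[of 1 "\<lambda>_. x"] by simp
  have "(\<Sum>i\<le>k. ?f i * ?f (k - i)) = 2 *\<^sub>R ?f k - (if k = 1 then x else 0)" for k
  proof -
    have "(\<Sum>i\<le>k. ?f i * ?f (k - i)) = (\<Sum>i\<le>k. sqrt_coeff i * sqrt_coeff (k - i)) *\<^sub>R x ^ k"
      unfolding scaleR_sum_left
      by (rule sum.cong) (auto simp flip: power_add)
    then show ?thesis by (simp add: sqrt_coeff_convolution scaleR_left_diff_distrib)
  qed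
  then have "(\<lambda>k. 2 *\<^sub>R ?f k - (if k = 1 then x else 0)) sums (sqrt_series x * sqrt_series x)"
    using Cauchy_product_sums[OF summable_norm_sqrt_series summable_norm_sqrt_series]
    by (simp add: sqrt_series_def)
  moreover have "(\<lambda>k. 2 *\<^sub>R ?f k - (if k = 1 then x else 0)) sums (2 *\<^sub>R sqrt_series x - x)"
    unfolding sqrt_series_def
    by (intro sums_diff sums_scaleR_right summable_sums summable_sqrt_series sx)
  ultimately show ?thesis by (rule sums_unique2)
qed

lemma sqrt_series_bounded_linear:
  assumes "bounded_linear f" "\<And>n. f (x ^ n) = g n"
  shows "f (sqrt_series x) = (\<Sum>n. sqrt_coeff n *\<^sub>R g n)"
proof -
  interpret bounded_linear f by fact
  show ?thesis
    unfolding sqrt_series_def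
    by (subst suminf[OF summable_sqrt_series]) (simp add: scaleR assms)
qed

lemma sqrt_series_commute:
  assumes "z * x = x * z"
  shows "z * sqrt_series x = sqrt_series x * z"
proof -
  have "z * x ^ n = x ^ n * z" for n
    using assms by (simp add: power_commuting_commutes)
  then have "z * sqrt_series x = (\<Sum>n. sqrt_coeff n *\<^sub>R (x ^ n * z))"
    by (intro sqrt_series_bounded_linear bounded_linear_mult_right) auto
  also have "\<dots> = sqrt_series x * z"
    by (rule sqrt_series_bounded_linear[symmetric]) (auto intro: bounded_linear_mult_left)
  finally show ?thesis .
qed

end

section \<open>Involution, norm and positive cone of a C*-algebra\<close>

locale cstar =
  fixes sc :: "complex \<Rightarrow> 'a::{real_normed_algebra_1,banach} \<Rightarrow> 'a" and st :: "'a \<Rightarrow> 'a"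
  assumes cstar_alg: "cstar_alg sc st"
begin

lemma sc_of_real: "sc (complex_of_real r) a = r *\<^sub>R a"
  and sc_add_right: "sc c (a + b) = sc c a + sc c b"
  and sc_sc: "sc c (sc d a) = sc (c * d) a"
  and sc_mult_left: "sc c a * b = sc c (a * b)"
  and sc_mult_right: "a * sc c b = sc c (a * b)"
  and norm_sc: "norm (sc c a) = cmod c * norm a"
  and st_add: "st (a + b) = st a + st b"
  and st_sc: "st (sc c a) = sc (cnj c) (st a)"
  and st_mult: "st (a * b) = st b * st a"
  and st_st [simp]: "st (st a) = a"
  and norm_st_mult_self: "norm (st a * a) = (norm a)\<^sup>2"
  using cstar_alg unfolding cstar_alg_def by simp_all

lemma sc_one [simp]: "sc 1 a = a"
  using sc_of_real[of 1 a] by simp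

lemma sc_minus_one: "sc (-1) a = - a"
  using sc_of_real[of "-1" a] by simp

lemma st_one [simp]: "st 1 = 1"
proof -
  have "st (st 1 * 1) = st 1 * st (st 1)" by (rule st_mult)
  then show ?thesis by simp
qed

lemma st_scaleR [simp]: "st (r *\<^sub>R a) = r *\<^sub>R st a"
  using st_sc[of "complex_of_real r" a] by (simp add: sc_of_real)

lemma st_zero [simp]: "st 0 = 0"
  using st_scaleR[of 0 0] by simp

lemma st_minus [simp]: "st (- a) = - st a"
  using st_scaleR[of "-1" a] by simp

lemma st_diff: "st (a - b) = st a - st b"
  using st_add[of a "- b"] by simp

lemma st_sum: "st (sum f F) = (\<Sum>i\<in>F. st (f i))"
  by (induction F rule: infinite_finite_induct) (auto simp: st_add)

lemma norm_st [simp]: "norm (st a) = norm a"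
proof -
  have le: "norm b \<le> norm (st b)" for b
  proof (cases "b = 0")
    case False
    have "norm b * norm b \<le> norm (st b) * norm b"
      using norm_st_mult_self[of b] norm_mult_ineq[of "st b" b] by (simp add: power2_eq_square)
    then show ?thesis using False by simp
  qed simp
  from le[of a] le[of "st a"] show ?thesis by simp
qed

lemma bounded_linear_st: "bounded_linear st"
  by (rule bounded_linear_intro[where K = 1]) (auto simp: st_add)

lemma bounded_linear_sc: "bounded_linear (sc c)"
proof (rule bounded_linear_intro[where K = "cmod c"])
  show "sc c (r *\<^sub>R x) = r *\<^sub>R sc c x" for r x
    by (simp add: sc_sc mult.commute flip: sc_of_real)
qed (auto simp: sc_add_right norm_sc mult.commute)

lemma st_mult_self_eq_0: "st a * a = 0 \<Longrightarrow> a = 0"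
  using norm_st_mult_self[of a] by simp

lemma norm_square_selfadjoint: "st a = a \<Longrightarrow> norm (a * a) = (norm a)\<^sup>2"
  using norm_st_mult_self[of a] by simp

lemma st_power: "st (a ^ n) = st a ^ n"
  by (induction n) (auto simp: st_mult power_commutes)

text \<open>A description of the positive cone that makes it visibly convex and avoids the spectrum;
  the lemma positive_el_iff_pos_cone identifies it with the elements \<open>b\<^sup>* b\<close>.\<close>

definition pos_cone :: "'a \<Rightarrow> bool" where
  "pos_cone a \<longleftrightarrow> st a = a \<and> (\<exists>t\<ge>0. norm (t *\<^sub>R 1 - a) \<le> t)"

lemma pos_cone_selfadjoint: "pos_cone a \<Longrightarrow> st a = a"
  by (simp add: pos_cone_def)

lemma pos_coneI: "st a = a \<Longrightarrow> norm (t *\<^sub>R 1 - a) \<le> t \<Longrightarrow> pos_cone a"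
  unfolding pos_cone_def using norm_ge_zero order_trans by blast

lemma pos_cone_0 [simp]: "pos_cone 0"
  by (rule pos_coneI[of _ 0]) auto

lemma pos_cone_add:
  assumes "pos_cone a" "pos_cone b"
  shows "pos_cone (a + b)"
proof -
  obtain t s where ts: "norm (t *\<^sub>R 1 - a) \<le> t" "norm (s *\<^sub>R 1 - b) \<le> s"
    using assms unfolding pos_cone_def by blast
  have "norm ((t + s) *\<^sub>R 1 - (a + b)) \<le> norm (t *\<^sub>R 1 - a) + norm (s *\<^sub>R 1 - b)"
    by (rule order_trans[OF eq_refl norm_triangle_ineq]) (simp add: algebra_simps)
  then show ?thesis
    using assms ts by (intro pos_coneI[of _ "t + s"]) (auto simp: st_add pos_cone_selfadjoint)
qed

lemma pos_cone_scaleR: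
  assumes "pos_cone a" "r \<ge> 0"
  shows "pos_cone (r *\<^sub>R a)"
proof -
  obtain t where t: "norm (t *\<^sub>R 1 - a) \<le> t" 
    using assms unfolding pos_cone_def by blast
  have "norm ((r * t) *\<^sub>R 1 - r *\<^sub>R a) = r * norm (t *\<^sub>R 1 - a)"
    using assms by (simp flip: scaleR_scaleR scaleR_diff_right)
  then show ?thesis
    using assms t by (intro pos_coneI[of _ "r * t"]) (auto simp: pos_cone_selfadjoint mult_left_mono)
qed

text \<open>The order bound of a self-adjoint element by its norm. It is immediate from the
  definition of the cone, since subtracting the element from \<open>norm a *\<^sub>R 1\<close>
  returns \<open>a\<close>.\<close>

lemma pos_cone_norm_diff: "st a = a \<Longrightarrow> pos_cone (norm a *\<^sub>R 1 - a)"
  by (rule pos_coneI[of _ "norm a"]) (auto simp: st_diff)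

text \<open>Membership in the cone says that \<open>a\<close> is \<open>t\<close> times
  \<open>1 - x\<close> with \<open>norm x \<le> 1\<close>, so the series applies to
  \<open>x\<close>. The commutation clause does the work of a functional calculus: it makes roots of
  commuting elements commute.\<close>

lemma pos_cone_sqrt:
  assumes "pos_cone a"
  obtains p where "pos_cone p" "p * p = a" "\<And>z. z * a = a * z \<Longrightarrow> z * p = p * z"
proof -
  obtain t0 where t0: "t0 \<ge> 0" "norm (t0 *\<^sub>R 1 - a) \<le> t0"
    using assms unfolding pos_cone_def by blast
  \<comment> \<open>The parameter may be 0 (for \<open>a = 0\<close>); adding 1 makes division by it
    possible and preserves the bound because \<open>norm 1 = 1\<close>.\<close>
  define t where "t = t0 + 1"
  have t: "t > 0" using t0 by (simp add: t_def)
  have "norm (t *\<^sub>R 1 - a) \<le> norm (t0 *\<^sub>R 1 - a) + norm (1::'a)"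
    by (rule order_trans[OF eq_refl norm_triangle_ineq]) (simp add: t_def algebra_simps)
  then have nt: "norm (t *\<^sub>R 1 - a) \<le> t" using t0 by (simp add: t_def)
  define x where "x = (1/t) *\<^sub>R (t *\<^sub>R 1 - a)"
  have xa: "x = 1 - (1/t) *\<^sub>R a" using t by (simp add: x_def algebra_simps)
  have nx: "norm x \<le> 1" using nt t by (simp add: x_def)
  have stx: "st x = x" using pos_cone_selfadjoint[OF assms] by (simp add: xa st_diff)
  define s where "s = sqrt_series x"
  have sts: "st s = s"
    unfolding s_def
    by (subst sqrt_series_bounded_linear[OF nx bounded_linear_st, where g = "\<lambda>n. x ^ n"])
       (auto simp: st_power stx sqrt_series_def)
  define p where "p = sqrt t *\<^sub>R (1 - s)"
  have "pos_cone (1 - s)"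
    by (rule pos_coneI[of _ 1]) (use norm_sqrt_series_le[OF nx] sts in \<open>auto simp: s_def st_diff\<close>)
  then have "pos_cone p" unfolding p_def using t by (intro pos_cone_scaleR) auto
  moreover have "p * p = a"
  proof -
    have "s * s = 2 *\<^sub>R s - x" unfolding s_def by (rule sqrt_series_square[OF nx])
    then have "(1 - s) * (1 - s) = 1 - x"
      by (simp add: algebra_simps scaleR_2)
    then show ?thesis using t by (simp add: p_def xa)
  qed
  moreover have "z * p = p * z" if "z * a = a * z" for z
  proof -
    have "z * x = x * z" using that by (simp add: xa algebra_simps)
    then have "z * s = s * z" unfolding s_def by (rule sqrt_series_commute[OF nx])
    then show ?thesis by (simp add: p_def algebra_simps)
  qed
  ultimately show ?thesis using that by blast
qed

section \<open>Real and imaginary parts, and positivity of \<open>st b * b\<close>\<close>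

abbreviation iu :: "'a \<Rightarrow> 'a" where "iu \<equiv> sc \<i>"

lemma iu_iu: "iu (iu a) = - a"
  by (simp add: sc_sc sc_minus_one)

lemma st_iu: "st (iu a) = - iu (st a)"
proof -
  have "sc (-\<i>) (st a) = sc (-1) (sc \<i> (st a))" by (simp add: sc_sc)
  then show ?thesis by (simp add: st_sc sc_minus_one)
qed

lemma iu_mult: "iu a * b = iu (a * b)" "a * iu b = iu (a * b)"
  by (rule sc_mult_left sc_mult_right)+

lemma iu_minus: "iu (- a) = - iu a"
proof -
  have "iu (sc (-1) a) = sc (-1) (iu a)" by (simp add: sc_sc)
  then show ?thesis by (simp add: sc_minus_one)
qed

lemma iu_diff: "iu (a - b) = iu a - iu b"
  using sc_add_right[of \<i> a "- b"] by (simp add: iu_minus)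

lemmas iu_simps = iu_iu st_iu iu_mult iu_minus iu_diff sc_add_right

lemma selfadjoint_parts:
  obtains x y where "st x = x" "st y = y" "a = x + iu y"
proof
  let ?x = "(1/2) *\<^sub>R (a + st a)" and ?y = "iu ((1/2) *\<^sub>R (st a - a))"
  show "st ?x = ?x" by (simp add: st_add add.commute)
  show "st ?y = ?y" by (simp add: st_iu st_diff iu_diff flip: iu_minus scaleR_minus_right)
  have "?x + iu ?y = ?x - (1/2) *\<^sub>R (st a - a)" by (simp add: iu_iu)
  also have "\<dots> = (1/2) *\<^sub>R a + (1/2) *\<^sub>R a" by (simp add: algebra_simps)
  also have "\<dots> = a" by (simp flip: scaleR_left_distrib)
  finally show "a = ?x + iu ?y" by simp
qed

text \<open>The element \<open>u = p + iu q\<close> is normal with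
  \<open>st u * u = p * p + q * q\<close>, and \<open>p\<close> is its real part. Identities between
  squares thus become norm estimates for \<open>p\<close>.\<close>

lemma norm_commuting_square_sum:
  assumes "st p = p" "st q = q" "p * q = q * p"
  shows "(norm (p + iu q))\<^sup>2 = norm (p * p + q * q)" and "norm p \<le> norm (p + iu q)"
proof -
  let ?u = "p + iu q"
  have su: "st ?u = p - iu q" by (simp add: assms st_add st_iu)
  have "st ?u * ?u = p * p + q * q"
    unfolding su by (simp add: algebra_simps iu_simps assms)
  then show "(norm ?u)\<^sup>2 = norm (p * p + q * q)" by (metis norm_st_mult_self)
  have "2 *\<^sub>R p = ?u + st ?u" by (simp add: su scaleR_2)
  then have "2 * norm p \<le> norm ?u + norm (st ?u)"
    by (metis norm_scaleR norm_triangle_ineq abs_numeral)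
  then show "norm p \<le> norm ?u" by simp
qed

text \<open>Normalise to \<open>norm b = 1\<close> and imitate cosine and sine: with
  \<open>s\<close> a root of \<open>1 - b * b\<close>, the element \<open>u = b + iu s\<close> has
  norm 1. The real part of \<open>u * u\<close> is \<open>2 *\<^sub>R (b * b) - 1\<close> and has
  norm at most 1, which is the cone condition for \<open>b * b\<close> with parameter 1/2.\<close>

lemma pos_cone_square:
  assumes sa: "st a = a"
  shows "pos_cone (a * a)"
proof (cases "a = 0")
  case False
  define b where "b = (1 / norm a) *\<^sub>R a"
  have sb: "st b = b" and nb: "norm b = 1" using sa False by (auto simp: b_def)
  have ab: "a * a = ((norm a)\<^sup>2) *\<^sub>R (b * b)"
    using False by (simp add: b_def power2_eq_square)
  have "norm (1 *\<^sub>R 1 - (1 - b * b)) \<le> 1"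
    using norm_mult_ineq[of b b] nb by simp
  then have "pos_cone (1 - b * b)"
    by (intro pos_coneI[of _ 1]) (auto simp: st_diff st_mult sb)
  then obtain s where s: "pos_cone s" "s * s = 1 - b * b"
      "\<And>z. z * (1 - b * b) = (1 - b * b) * z \<Longrightarrow> z * s = s * z"
    using pos_cone_sqrt by blast
  have bs: "b * s = s * b" by (rule s(3)) (simp add: algebra_simps)
  have ss: "st s = s" using s(1) by (simp add: pos_cone_selfadjoint)
  let ?u = "b + iu s"
  have "(norm ?u)\<^sup>2 = norm (b * b + s * s)"
    by (rule norm_commuting_square_sum[OF sb ss bs])
  then have "norm ?u = 1" by (simp add: s(2) power2_eq_1_iff) (use norm_ge_zero[of ?u] in linarith)
  then have nu: "norm (?u * ?u) \<le> 1" using norm_mult_ineq[of ?u ?u] by simp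
  have "?u * ?u = (b * b - s * s) + iu (2 *\<^sub>R (b * s))"
    by (simp add: algebra_simps iu_simps bs scaleR_2)
  moreover have "st (b * s) = b * s" by (simp add: st_mult ss sb bs)
  ultimately have uu: "?u * ?u = (b * b - s * s) + iu (2 *\<^sub>R (b * s))"
      "st (?u * ?u) = (b * b - s * s) - iu (2 *\<^sub>R (b * s))"
    by (auto simp: st_add st_diff st_iu st_mult sb ss)
  have "4 *\<^sub>R ((1/2) *\<^sub>R 1 - b * b) = - (?u * ?u + st (?u * ?u))"
    unfolding uu(2) unfolding uu(1) s(2) by (simp add: algebra_simps flip: scaleR_2)
  then have "norm (4 *\<^sub>R ((1/2) *\<^sub>R 1 - b * b)) = norm (?u * ?u + st (?u * ?u))"
    by (simp only: norm_minus_cancel)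
  then have "4 * norm ((1/2) *\<^sub>R 1 - b * b) \<le> norm (?u * ?u) + norm (st (?u * ?u))"
    using norm_triangle_ineq[of "?u * ?u" "st (?u * ?u)"] by simp
  then have "norm ((1/2) *\<^sub>R 1 - b * b) \<le> 1/2" using nu by simp
  then have "pos_cone (b * b)" by (intro pos_coneI[of _ "1/2"]) (auto simp: st_mult sb)
  then show ?thesis unfolding ab by (rule pos_cone_scaleR) simp
qed simp

text \<open>Commuting roots \<open>p\<close> of \<open>a\<close> and \<open>q\<close> of
  \<open>- a\<close> have \<open>p * p + q * q = 0\<close>, so \<open>p + iu q\<close> vanishes in
  norm and its real part \<open>p\<close> with it.\<close>

lemma pos_cone_antisym:
  assumes "pos_cone a" "pos_cone (- a)"
  shows "a = 0"
proof -
  obtain p where p: "pos_cone p" "p * p = a" "\<And>z. z * a = a * z \<Longrightarrow> z * p = p * z"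
    using pos_cone_sqrt[OF assms(1)] by blast
  obtain q where q: "pos_cone q" "q * q = - a" "\<And>z. z * (- a) = (- a) * z \<Longrightarrow> z * q = q * z"
    using pos_cone_sqrt[OF assms(2)] by blast
  have "p * a = a * p" using p(2) by (metis mult.assoc)
  then have pq: "p * q = q * p" by (intro q(3)) simp
  have "norm (p + iu q) = 0"
    using norm_commuting_square_sum(1)[of p q] p(1,2) q(1,2) pq by (simp add: pos_cone_selfadjoint)
  then have "norm p \<le> 0"
    using norm_commuting_square_sum(2)[of p q] p(1,2) q(1,2) pq by (simp add: pos_cone_selfadjoint)
  then show ?thesis using p(2) by simp
qed

text \<open>Writing \<open>c = x + iu y\<close>, the mixed terms of the two products cancel and a
  sum of self-adjoint squares is left. At this point neither product is known to be positive by
  itself.\<close>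

lemma pos_cone_st_mult_plus: "pos_cone (st c * c + c * st c)"
proof -
  obtain x y where xy: "st x = x" "st y = y" "c = x + iu y" by (rule selfadjoint_parts)
  have "st c * c + c * st c = 2 *\<^sub>R (x * x + y * y)"
    by (simp add: xy st_add st_iu) (simp add: algebra_simps iu_simps scaleR_2)
  then show ?thesis
    using xy by (auto intro!: pos_cone_scaleR pos_cone_add pos_cone_square)
qed

text \<open>If \<open>c\<^sup>* c = - q\<^sup>2\<close> then \<open>c c\<^sup>* = p\<^sup>2\<close> is positive, and \<open>d = q c\<^sup>*\<close> has both
  \<open>d\<^sup>* d = - p\<^sup>4\<close> and \<open>d d\<^sup>* = - q\<^sup>4\<close> negative, while \<open>d\<^sup>* d + d d\<^sup>*\<close> is always positive.\<close>

lemma st_mult_self_negative_imp_0: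
  assumes q: "st q = q" "st c * c = - (q * q)"
  shows "c = 0"
proof -
  have "pos_cone (q * q)" by (rule pos_cone_square) fact
  then have "pos_cone ((st c * c + c * st c) + q * q)"
    by (intro pos_cone_add pos_cone_st_mult_plus)
  then have "pos_cone (c * st c)" by (simp add: q)
  then obtain p where p: "pos_cone p" "p * p = c * st c"
    by (rule pos_cone_sqrt)
  have sp: "st p = p" using p by (simp add: pos_cone_selfadjoint)
  let ?p2 = "p * p" and ?q2 = "q * q"
  have s2: "st ?p2 = ?p2" "st ?q2 = ?q2" using sp q by (auto simp: st_mult)
  define d where "d = q * st c"
  have "st d * d = c * (q * q) * st c" by (simp add: d_def st_mult q mult.assoc)
  also have "q * q = - (st c * c)" by (simp add: q)
  also have "c * (- (st c * c)) * st c = - (?p2 * ?p2)" by (simp add: p(2) mult.assoc)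
  finally have dd: "st d * d = - (?p2 * ?p2)" .
  have "d * st d = q * (st c * c) * q" by (simp add: d_def st_mult q(1) mult.assoc)
  then have dd': "d * st d = - (?q2 * ?q2)" by (simp add: q(2) mult.assoc)
  have P: "pos_cone (?p2 * ?p2)" "pos_cone (?q2 * ?q2)"
    using s2 by (auto intro: pos_cone_square)
  have "pos_cone ((st d * d + d * st d) + ?q2 * ?q2)"
    by (rule pos_cone_add[OF pos_cone_st_mult_plus P(2)])
  then have "pos_cone (- (?p2 * ?p2))" by (simp add: dd dd')
  with P(1) have "?p2 * ?p2 = 0" by (rule pos_cone_antisym)
  then have "?p2 = 0" using norm_square_selfadjoint[OF s2(1)] by simp
  then have "st (st c) * st c = 0" using p by simp
  then have "st c = 0" by (rule st_mult_self_eq_0)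
  then show ?thesis by (metis st_st st_zero)
qed

text \<open>Here \<open>k\<close> plays the absolute value of \<open>a = st b * b\<close>,
  \<open>s\<close> its root, and \<open>m = k - a\<close> is twice the negative part. Since
  \<open>a * m = - (k * m)\<close>, the element \<open>c = b * m\<close> has
  \<open>st c * c = - (m * s)^2\<close>, so it is 0. Then \<open>a * m = 0\<close>, hence
  \<open>m * m = - 2 *\<^sub>R (a * m) = 0\<close>, and \<open>a\<close> equals its absolute
  value.\<close>

lemma pos_cone_st_mult_self: "pos_cone (st b * b)"
proof -
  define a where "a = st b * b"
  have sa: "st a = a" by (simp add: a_def st_mult)
  obtain k where k: "pos_cone k" "k * k = a * a" "\<And>z. z * (a * a) = (a * a) * z \<Longrightarrow> z * k = k * z"
    using pos_cone_sqrt[OF pos_cone_square[OF sa]] by blast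
  obtain s where s: "pos_cone s" "s * s = k" "\<And>z. z * k = k * z \<Longrightarrow> z * s = s * z"
    using pos_cone_sqrt[OF k(1)] by blast
  have ak: "a * k = k * a" by (rule k(3)) (simp add: mult.assoc)
  have as: "a * s = s * a" by (rule s(3)) (rule ak)
  have ks: "k * s = s * k" by (rule s(3)) simp
  define m where "m = k - a"
  have sk: "st k = k" "st s = s" using k(1) s(1) by (auto simp: pos_cone_selfadjoint)
  have sm: "st m = m" by (simp add: m_def st_diff sk sa)
  have am: "a * m = - (k * m)" by (simp add: m_def algebra_simps k(2) ak)
  have ms: "m * s = s * m" by (simp add: m_def algebra_simps as ks)
  have "st (b * m) * (b * m) = m * (a * m)"
    by (simp add: st_mult sm a_def mult.assoc)
  also have "\<dots> = - (m * (s * s) * m)" by (simp add: am s(2)) (simp add: mult.assoc)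
  also have "\<dots> = - ((m * s) * (m * s))" by (metis mult.assoc ms)
  finally have bm: "st (b * m) * (b * m) = - ((m * s) * (m * s))" .
  have sms: "st (m * s) = m * s" by (simp add: st_mult sm sk ms)
  have "b * m = 0" by (rule st_mult_self_negative_imp_0[OF sms bm])
  then have "a * m = 0" by (simp add: a_def mult.assoc)
  then have "m * m = 0" using am by (simp add: m_def algebra_simps)
  then have "m = 0" using norm_square_selfadjoint[OF sm] by simp
  then show ?thesis using k(1) by (simp add: m_def a_def)
qed

lemma positive_el_iff_pos_cone: "positive_el st a \<longleftrightarrow> pos_cone a"
proof
  show "positive_el st a \<Longrightarrow> pos_cone a"
    unfolding positive_el_def using pos_cone_st_mult_self by blast
  show "positive_el st a" if "pos_cone a"
    using pos_cone_sqrt[OF that] pos_cone_selfadjoint unfolding positive_el_def by metis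
qed

text \<open>Commuting roots \<open>p\<close> of \<open>a\<close> and \<open>q\<close> of
  \<open>s *\<^sub>R 1 - a\<close> satisfy \<open>p * p + q * q = s *\<^sub>R 1\<close>. So
  \<open>p + iu q\<close> has squared norm \<open>s\<close>, which bounds the squared norm of
  \<open>p\<close>, that is \<open>norm a\<close>.\<close>

lemma pos_cone_le_norm:
  assumes "pos_cone a" "pos_cone (s *\<^sub>R 1 - a)" "s \<ge> 0"
  shows "norm a \<le> s"
proof -
  obtain p where p: "pos_cone p" "p * p = a" "\<And>z. z * a = a * z \<Longrightarrow> z * p = p * z"
    using pos_cone_sqrt[OF assms(1)] by blast
  obtain q where q: "pos_cone q" "q * q = s *\<^sub>R 1 - a"
      "\<And>z. z * (s *\<^sub>R 1 - a) = (s *\<^sub>R 1 - a) * z \<Longrightarrow> z * q = q * z"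
    using pos_cone_sqrt[OF assms(2)] by blast
  have "p * a = a * p" using p(2) by (metis mult.assoc)
  then have pq: "p * q = q * p" by (intro q(3)) (simp add: algebra_simps)
  have sp: "st p = p" "st q = q" using p(1) q(1) by (auto simp: pos_cone_selfadjoint)
  have "norm a = (norm p)\<^sup>2" using norm_square_selfadjoint[OF sp(1)] p(2) by simp
  also have "\<dots> \<le> (norm (p + iu q))\<^sup>2"
    using norm_commuting_square_sum(2)[OF sp pq] by (intro power_mono) auto
  also have "\<dots> = \<bar>s\<bar>" using norm_commuting_square_sum(1)[OF sp pq] by (simp add: p(2) q(2))
  finally show ?thesis using \<open>s \<ge> 0\<close> by simp
qed

lemma pos_cone_norm_mono:
  assumes "pos_cone a" "pos_cone (b - a)"
  shows "norm a \<le> norm b"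
proof -
  have "pos_cone b" using pos_cone_add[OF assms] by simp
  then have "pos_cone ((norm b *\<^sub>R 1 - b) + (b - a))"
    by (intro pos_cone_add pos_cone_norm_diff assms) (rule pos_cone_selfadjoint)
  then show ?thesis using assms by (intro pos_cone_le_norm) auto
qed

end

section \<open>Summability and the Cauchy-Schwarz inequality\<close>

text \<open>Reduces unconditional convergence to norms of finite sums off a finite set, which is
  where order comparison and Cauchy-Schwarz can be applied.\<close>

lemma summable_on_iff_Cauchy:
  fixes f :: "'i \<Rightarrow> 'b::banach"
  shows "f summable_on A \<longleftrightarrow>
    (\<forall>e>0. \<exists>F0. finite F0 \<and> F0 \<subseteq> A \<and> (\<forall>F. finite F \<and> F \<subseteq> A - F0 \<longrightarrow> norm (sum f F) < e))"
    (is "_ \<longleftrightarrow> ?C")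
proof
  assume "f summable_on A"
  then obtain S where S: "(sum f \<longlongrightarrow> S) (finite_subsets_at_top A)"
    unfolding summable_on_def has_sum_def by blast
  show ?C
  proof (intro allI impI)
    fix e :: real assume "e > 0"
    then have "\<forall>\<^sub>F F in finite_subsets_at_top A. dist (sum f F) S < e/2"
      using S by (intro tendstoD) auto
    then obtain F0 where F0: "finite F0" "F0 \<subseteq> A"
        "\<forall>F. finite F \<and> F0 \<subseteq> F \<and> F \<subseteq> A \<longrightarrow> dist (sum f F) S < e/2"
      unfolding eventually_finite_subsets_at_top by blast
    have "norm (sum f F) < e" if "finite F \<and> F \<subseteq> A - F0" for F
    proof -
      have "sum f F = sum f (F0 \<union> F) - sum f F0"
        using that F0(1) by (subst sum.union_disjoint) auto
      moreover have "dist (sum f (F0 \<union> F)) S < e/2" "dist (sum f F0) S < e/2"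
        using that F0 by auto
      ultimately show ?thesis
        using dist_triangle_half_l[of "sum f (F0 \<union> F)" S e "sum f F0"] by (simp add: dist_norm norm_minus_commute)
    qed
    then show "\<exists>F0. finite F0 \<and> F0 \<subseteq> A \<and> (\<forall>F. finite F \<and> F \<subseteq> A - F0 \<longrightarrow> norm (sum f F) < e)"
      using F0 by blast
  qed
next
  assume C: ?C
  have "\<exists>P. eventually P (finite_subsets_at_top A) \<and>
              (\<forall>F F'. P F \<and> P F' \<longrightarrow> dist (sum f F) (sum f F') < e)" if "e > 0" for e
  proof -
    obtain F0 where F0: "finite F0" "F0 \<subseteq> A" "\<forall>F. finite F \<and> F \<subseteq> A - F0 \<longrightarrow> norm (sum f F) < e/2"
      using C[rule_format, of "e/2"] \<open>e > 0\<close> by auto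
    let ?P = "\<lambda>F. finite F \<and> F0 \<subseteq> F \<and> F \<subseteq> A"
    have d: "dist (sum f F) (sum f F0) < e/2" if "?P F" for F
    proof -
      have "sum f F - sum f F0 = sum f (F - F0)" using that F0(1) by (simp add: sum_diff)
      moreover have "norm (sum f (F - F0)) < e/2" using that F0(3) by auto
      ultimately show ?thesis by (simp add: dist_norm)
    qed
    show ?thesis
    proof (intro exI[of _ ?P] conjI allI impI)
      show "eventually ?P (finite_subsets_at_top A)"
        unfolding eventually_finite_subsets_at_top using F0 by blast
      show "dist (sum f F) (sum f F') < e" if "?P F \<and> ?P F'" for F F'
        using d[of F] d[of F'] that by (metis dist_triangle_half_l)
    qed
  qed
  then have "cauchy_filter (filtermap (sum f) (finite_subsets_at_top A))"
    by (simp add: cauchy_filter_metric_filtermap)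
  moreover have "complete (UNIV::'b set)"
    by (meson Cauchy_convergent UNIV_I complete_def convergent_def)
  ultimately obtain L' where "(sum f \<longlongrightarrow> L') (finite_subsets_at_top A)"
    using complete_uniform[where S=UNIV] by (force simp add: filterlim_def)
  then show "f summable_on A"
    using summable_on_def has_sum_def by blast
qed

context cstar
begin

lemma pos_cone_conj:
  assumes "pos_cone a"
  shows "pos_cone (st b * a * b)"
proof -
  obtain c where "a = st c * c"
    using assms positive_el_iff_pos_cone unfolding positive_el_def by blast
  then have "st b * a * b = st (c * b) * (c * b)" by (simp add: st_mult mult.assoc)
  then show ?thesis using pos_cone_st_mult_self by simp
qed

lemma pos_cone_sum: "(\<And>i. i \<in> F \<Longrightarrow> pos_cone (f i)) \<Longrightarrow> pos_cone (sum f F)"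
  by (induction F rule: infinite_finite_induct) (auto intro: pos_cone_add)

text \<open>Fixing the existential parameter to \<open>norm a\<close> turns the cone into the
  solution set of continuous conditions, from which its closedness is read off.\<close>

lemma pos_cone_iff_norm:
  "pos_cone a \<longleftrightarrow> st a = a \<and> norm (norm a *\<^sub>R 1 - a) \<le> norm a"
proof
  assume a: "pos_cone a"
  have "norm (norm a *\<^sub>R 1 - a) \<le> norm a"
    by (rule pos_cone_le_norm) (use a in \<open>auto intro: pos_cone_norm_diff pos_cone_selfadjoint\<close>)
  then show "st a = a \<and> norm (norm a *\<^sub>R 1 - a) \<le> norm a"
    using a by (simp add: pos_cone_selfadjoint)
qed (auto intro: pos_coneI)

lemma closed_pos_cone: "closed {a. pos_cone a}"
  unfolding pos_cone_iff_norm
  by (intro closed_Collect_conj closed_Collect_eq closed_Collect_le continuous_intros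
        linear_continuous_on bounded_linear_st)

lemma pos_cone_infsum:
  assumes "\<And>i. i \<in> A \<Longrightarrow> pos_cone (f i)"
  shows "pos_cone (infsum f A)"
\<comment> \<open>If the family is not summable, \<open>infsum\<close> takes its default value 0,
  which lies in the cone as well.\<close>
proof (cases "f summable_on A")
  case True
  then have "(sum f \<longlongrightarrow> infsum f A) (finite_subsets_at_top A)"
    using has_sum_infsum has_sum_def by blast
  moreover have "\<forall>\<^sub>F F in finite_subsets_at_top A. sum f F \<in> {a. pos_cone a}"
    using assms by (intro eventually_finite_subsets_at_top_weakI) (auto intro!: pos_cone_sum)
  ultimately have "infsum f A \<in> {a. pos_cone a}"
    by (rule Lim_in_closed_set[OF closed_pos_cone _ finite_subsets_at_top_neq_bot, rotated])
  then show ?thesis by simp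
qed (simp add: infsum_not_exists)

lemma norm_sum_le_norm_infsum:
  assumes "f summable_on A" "\<And>i. i \<in> A \<Longrightarrow> pos_cone (f i)" "finite F" "F \<subseteq> A"
  shows "norm (sum f F) \<le> norm (infsum f A)"
proof (rule pos_cone_norm_mono)
  show "pos_cone (sum f F)" using assms by (intro pos_cone_sum) auto
  have "infsum f A = infsum f F + infsum f (A - F)"
    using assms by (subst infsum_Un_disjoint[symmetric])
      (auto intro: summable_on_subset_banach simp: Un_absorb1)
  then have "infsum f A - sum f F = infsum f (A - F)" using assms by simp
  then show "pos_cone (infsum f A - sum f F)" using assms by (auto intro: pos_cone_infsum)
qed

lemma summable_on_pos_cone_comparison:
  assumes "h summable_on A" "\<And>i. i \<in> A \<Longrightarrow> pos_cone (f i)" "\<And>i. i \<in> A \<Longrightarrow> pos_cone (h i - f i)"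
  shows "f summable_on A"
  unfolding summable_on_iff_Cauchy
proof (intro allI impI)
  fix e :: real assume "e > 0"
  then obtain F0 where F0: "finite F0" "F0 \<subseteq> A" "\<forall>F. finite F \<and> F \<subseteq> A - F0 \<longrightarrow> norm (sum h F) < e"
    using assms(1) unfolding summable_on_iff_Cauchy by metis
  have "norm (sum f F) < e" if "finite F \<and> F \<subseteq> A - F0" for F
  proof -
    have "norm (sum f F) \<le> norm (sum h F)"
      using that assms(2,3)
      by (intro pos_cone_norm_mono) (auto intro!: pos_cone_sum simp flip: sum_subtractf)
    then show ?thesis using F0(3) that by force
  qed
  then show "\<exists>F0. finite F0 \<and> F0 \<subseteq> A \<and> (\<forall>F. finite F \<and> F \<subseteq> A - F0 \<longrightarrow> norm (sum f F) < e)"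
    using F0 by blast
qed

end

text \<open>No definiteness is asked for: besides a Hilbert module, this is to cover functions into
  \<open>X\<close> with the inner product summed over a finite set F, which vanishes on functions
  supported off F.\<close>

locale semi_inner_module = cstar sc st
  for sc :: "complex \<Rightarrow> 'a::{real_normed_algebra_1,banach} \<Rightarrow> 'a" and st :: "'a \<Rightarrow> 'a" +
  fixes V :: "'v::ab_group_add set" and act :: "'v \<Rightarrow> 'a \<Rightarrow> 'v" and ip :: "'v \<Rightarrow> 'v \<Rightarrow> 'a"
  assumes V_add: "x \<in> V \<Longrightarrow> y \<in> V \<Longrightarrow> x + y \<in> V"
    and V_act: "x \<in> V \<Longrightarrow> act x a \<in> V"
    and ip_add_right: "x \<in> V \<Longrightarrow> y \<in> V \<Longrightarrow> z \<in> V \<Longrightarrow> ip x (y + z) = ip x y + ip x z"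
    and ip_act_right: "x \<in> V \<Longrightarrow> y \<in> V \<Longrightarrow> ip x (act y a) = ip x y * a"
    and st_ip: "x \<in> V \<Longrightarrow> y \<in> V \<Longrightarrow> st (ip x y) = ip y x"
    and ip_pos: "x \<in> V \<Longrightarrow> pos_cone (ip x x)"
begin

lemma ip_add_left: "x \<in> V \<Longrightarrow> y \<in> V \<Longrightarrow> z \<in> V \<Longrightarrow> ip (x + y) z = ip x z + ip y z"
  by (metis st_ip V_add ip_add_right st_add)

lemma ip_act_left: "x \<in> V \<Longrightarrow> y \<in> V \<Longrightarrow> ip (act x a) y = st a * ip x y"
  by (metis st_ip V_act ip_act_right st_mult)

text \<open>Expand the positive element \<open>ip z z\<close> for \<open>z = y - x b / P\<close>
  with \<open>b = ip x y\<close>. Replacing \<open>ip x x\<close> by its upper bound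
  \<open>P\<close> leaves \<open>ip y y - st b * b / P\<close> positive, and monotonicity of the
  norm gives the estimate with \<open>P\<close> in place of \<open>norm (ip x x)\<close>.\<close>

lemma Cauchy_Schwarz:
  assumes xy: "x \<in> V" "y \<in> V"
  shows "(norm (ip x y))\<^sup>2 \<le> norm (ip x x) * norm (ip y y)"
proof -
  let ?p = "ip x x" and ?q = "ip y y" and ?b = "ip x y"
  \<comment> \<open>Division by \<open>P\<close> must be possible even if \<open>ip x x = 0\<close>,
    hence the strict bound; \<open>P\<close> is lowered to \<open>norm (ip x x)\<close> at the
    end.\<close>
  have *: "(norm ?b)\<^sup>2 \<le> P * norm ?q" if P: "P > norm ?p" for P
  proof -
    have P0: "P > 0" using P norm_ge_zero[of ?p] by linarith
    define c where "c = (1/P) *\<^sub>R ?b"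
    define z where "z = y + act x (- c)"
    have ax: "act x (- c) \<in> V" using xy by (simp add: V_act)
    have two: "(2/P) *\<^sub>R B = (1/P) *\<^sub>R B + (1/P) *\<^sub>R B" for B :: 'a
      by (simp flip: scaleR_left_distrib)
    have "ip z z = ip y y + ip y x * (- c) + (st (- c) * ip x y + st (- c) * ip x x * (- c))"
      using xy ax
      by (simp add: z_def V_add ip_add_left ip_add_right ip_act_left ip_act_right mult.assoc left_diff_distrib)
    also have "ip y x = st ?b" using xy by (simp add: st_ip)
    finally have zz: "ip z z = ?q - (2/P) *\<^sub>R (st ?b * ?b) + (1/P\<^sup>2) *\<^sub>R (st ?b * ?p * ?b)"
      unfolding two c_def by (simp add: power2_eq_square)
    have "pos_cone ((P - norm ?p) *\<^sub>R 1 + (norm ?p *\<^sub>R 1 - ?p))"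
      using P xy
      by (intro pos_cone_add pos_cone_scaleR pos_cone_norm_diff)
         (auto intro: pos_coneI[of _ 1] simp: st_ip)
    then have "pos_cone (P *\<^sub>R 1 - ?p)" by (simp add: algebra_simps)
    then have "pos_cone (ip z z + (1/P\<^sup>2) *\<^sub>R (st ?b * (P *\<^sub>R 1 - ?p) * ?b))"
      using xy ax by (intro pos_cone_add ip_pos pos_cone_scaleR pos_cone_conj) (auto simp: z_def V_add)
    also have "ip z z + (1/P\<^sup>2) *\<^sub>R (st ?b * (P *\<^sub>R 1 - ?p) * ?b)
        = ?q - (2/P) *\<^sub>R (st ?b * ?b) + (P / P\<^sup>2) *\<^sub>R (st ?b * ?b)"
      unfolding zz by (simp add: algebra_simps)
    also have "\<dots> = ?q - (1/P) *\<^sub>R (st ?b * ?b)"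
      using P0 unfolding two by (simp add: power2_eq_square)
    finally have "norm ((1/P) *\<^sub>R (st ?b * ?b)) \<le> norm ?q"
      using P0 by (intro pos_cone_norm_mono pos_cone_scaleR pos_cone_st_mult_self) auto
    then show ?thesis using P0 by (simp add: norm_st_mult_self field_simps)
  qed
  show ?thesis
  proof (cases "?q = 0")
    case True
    then show ?thesis using *[of "norm ?p + 1"] by simp
  next
    case False
    have "(norm ?b)\<^sup>2 / norm ?q \<le> norm ?p"
      by (rule dense_ge) (use * False in \<open>auto simp: field_simps\<close>)
    then show ?thesis using False by (simp add: field_simps)
  qed
qed

lemma Cauchy_Schwarz_sqrt:
  assumes "x \<in> V" "y \<in> V"
  shows "norm (ip x y) \<le> sqrt (norm (ip x x)) * sqrt (norm (ip y y))"
  using real_sqrt_le_mono[OF Cauchy_Schwarz[OF assms]] by (simp add: real_sqrt_mult)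

lemma triangle_ineq:
  assumes "x \<in> V" "y \<in> V"
  shows "sqrt (norm (ip (x + y) (x + y))) \<le> sqrt (norm (ip x x)) + sqrt (norm (ip y y))"
    (is "_ \<le> ?r + ?s")
proof -
  have cs: "norm (ip x y) \<le> ?r * ?s" "norm (ip y x) \<le> ?s * ?r"
    using assms by (auto intro: Cauchy_Schwarz_sqrt)
  have "ip (x + y) (x + y) = ip x x + ip x y + (ip y x + ip y y)"
    using assms by (simp add: ip_add_left ip_add_right V_add)
  also have "norm \<dots> \<le> (norm (ip x x) + norm (ip x y)) + (norm (ip y x) + norm (ip y y))"
    by (intro order_trans[OF norm_triangle_ineq] add_mono norm_triangle_ineq)
  also have "\<dots> \<le> ?r\<^sup>2 + ?r * ?s + (?s * ?r + ?s\<^sup>2)" using cs by (intro add_mono) auto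
  also have "\<dots> = (?r + ?s)\<^sup>2" by (simp add: power2_eq_square algebra_simps)
  finally show ?thesis by (intro real_le_lsqrt) auto
qed

end

section \<open>Hilbert modules\<close>

locale hilbert_module = cstar sc st
  for sc :: "complex \<Rightarrow> 'a::{real_normed_algebra_1,banach} \<Rightarrow> 'a" and st :: "'a \<Rightarrow> 'a" +
  fixes X :: "('x::ab_group_add, 'a) hmod"
  assumes is_hmod: "is_hmod sc st X"
begin

lemma zero_mem [simp]: "0 \<in> hcar X"
  and add_mem [simp]: "x \<in> hcar X \<Longrightarrow> y \<in> hcar X \<Longrightarrow> x + y \<in> hcar X"
  and minus_mem [simp]: "x \<in> hcar X \<Longrightarrow> - x \<in> hcar X"
  and hsc_mem [simp]: "x \<in> hcar X \<Longrightarrow> hsc X c x \<in> hcar X"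
  and hact_mem [simp]: "x \<in> hcar X \<Longrightarrow> hact X x a \<in> hcar X"
  and hsc_add_right: "x \<in> hcar X \<Longrightarrow> y \<in> hcar X \<Longrightarrow> hsc X c (x + y) = hsc X c x + hsc X c y"
  and hsc_add_left: "x \<in> hcar X \<Longrightarrow> hsc X (c + d) x = hsc X c x + hsc X d x"
  and hsc_hsc: "x \<in> hcar X \<Longrightarrow> hsc X c (hsc X d x) = hsc X (c * d) x"
  and hsc_one [simp]: "x \<in> hcar X \<Longrightarrow> hsc X 1 x = x"
  and hact_add_left: "x \<in> hcar X \<Longrightarrow> y \<in> hcar X \<Longrightarrow> hact X (x + y) a = hact X x a + hact X y a"
  and hact_add_right: "x \<in> hcar X \<Longrightarrow> hact X x (a + b) = hact X x a + hact X x b"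
  and hact_mult: "x \<in> hcar X \<Longrightarrow> hact X x (a * b) = hact X (hact X x a) b"
  and hact_one [simp]: "x \<in> hcar X \<Longrightarrow> hact X x 1 = x"
  and hact_hsc: "x \<in> hcar X \<Longrightarrow> hact X (hsc X c x) a = hsc X c (hact X x a)"
  and hact_sc: "x \<in> hcar X \<Longrightarrow> hact X x (sc c a) = hsc X c (hact X x a)"
  and hip_hsc_right: "x \<in> hcar X \<Longrightarrow> y \<in> hcar X \<Longrightarrow> hip X x (hsc X c y) = sc c (hip X x y)"
  and hip_positive: "x \<in> hcar X \<Longrightarrow> positive_el st (hip X x x)"
  and hip_eq_0D: "x \<in> hcar X \<Longrightarrow> hip X x x = 0 \<Longrightarrow> x = 0"
  by (insert is_hmod[unfolded is_hmod_def]; elim conjE; meson)+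

lemma complete:
  assumes "\<And>n. s n \<in> hcar X"
    and "\<And>e. e > 0 \<Longrightarrow> \<exists>N::nat. \<forall>m\<ge>N. \<forall>n\<ge>N. hnorm X (s m - s n) < e"
  obtains l where "l \<in> hcar X" "\<And>e. e > 0 \<Longrightarrow> \<exists>N::nat. \<forall>n\<ge>N. hnorm X (s n - l) < e"
proof -
  have "\<forall>s. (\<forall>n. s n \<in> hcar X) \<longrightarrow>
          (\<forall>e>0. \<exists>N::nat. \<forall>m\<ge>N. \<forall>n\<ge>N. hnorm X (s m - s n) < e) \<longrightarrow>
          (\<exists>l\<in>hcar X. \<forall>e>0. \<exists>N::nat. \<forall>n\<ge>N. hnorm X (s n - l) < e)"
    by (insert is_hmod[unfolded is_hmod_def]; elim conjE; assumption)
  moreover have "\<forall>n. s n \<in> hcar X" "\<forall>e>0. \<exists>N. \<forall>m\<ge>N. \<forall>n\<ge>N. hnorm X (s m - s n) < e"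
    using assms by auto
  ultimately have "\<exists>l\<in>hcar X. \<forall>e>0. \<exists>N::nat. \<forall>n\<ge>N. hnorm X (s n - l) < e"
    by (elim allE[where x = s] impE)
  then show thesis using that by blast
qed

sublocale semi_inner_module sc st "hcar X" "hact X" "hip X"
proof
  fix x y z a assume "x \<in> hcar X" "y \<in> hcar X" "z \<in> hcar X"
  then show "hip X x (y + z) = hip X x y + hip X x z"
    by (insert is_hmod[unfolded is_hmod_def]; elim conjE; meson)
next
  fix x y a assume "x \<in> hcar X" "y \<in> hcar X"
  then show "hip X x (hact X y a) = hip X x y * a" and "st (hip X x y) = hip X y x"
    by (insert is_hmod[unfolded is_hmod_def]; elim conjE; metis)+
qed (auto intro: hip_positive simp flip: positive_el_iff_pos_cone)

lemma diff_mem [simp]: "x \<in> hcar X \<Longrightarrow> y \<in> hcar X \<Longrightarrow> x - y \<in> hcar X"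
  using add_mem[of x "- y"] by simp

lemma sum_mem [simp]: "(\<And>i. i \<in> F \<Longrightarrow> f i \<in> hcar X) \<Longrightarrow> sum f F \<in> hcar X"
  by (induction F rule: infinite_finite_induct) auto

lemma ip_zero_right [simp]: "x \<in> hcar X \<Longrightarrow> hip X x 0 = 0"
  using ip_add_right[of x 0 0] by simp

lemma ip_zero_left [simp]: "x \<in> hcar X \<Longrightarrow> hip X 0 x = 0"
  using ip_add_left[of 0 0 x] by simp

lemma ip_minus_right: "x \<in> hcar X \<Longrightarrow> y \<in> hcar X \<Longrightarrow> hip X x (- y) = - hip X x y"
  using ip_add_right[of x y "- y"] by (simp add: eq_neg_iff_add_eq_0 add.commute)

lemma ip_minus_left: "x \<in> hcar X \<Longrightarrow> y \<in> hcar X \<Longrightarrow> hip X (- x) y = - hip X x y"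
  using ip_add_left[of x "- x" y] by (simp add: eq_neg_iff_add_eq_0 add.commute)

lemma ip_diff_right: "x \<in> hcar X \<Longrightarrow> y \<in> hcar X \<Longrightarrow> z \<in> hcar X \<Longrightarrow>
    hip X x (y - z) = hip X x y - hip X x z"
  using ip_add_right[of x y "- z"] by (simp add: ip_minus_right)

lemma ip_diff_left: "x \<in> hcar X \<Longrightarrow> y \<in> hcar X \<Longrightarrow> z \<in> hcar X \<Longrightarrow>
    hip X (x - y) z = hip X x z - hip X y z"
  using ip_add_left[of x "- y" z] by (simp add: ip_minus_left)

lemma ip_sum_right: "x \<in> hcar X \<Longrightarrow> (\<And>i. i \<in> F \<Longrightarrow> f i \<in> hcar X) \<Longrightarrow>
    hip X x (sum f F) = (\<Sum>i\<in>F. hip X x (f i))"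
  by (induction F rule: infinite_finite_induct) (auto simp: ip_add_right)

lemma ip_sum_left: "x \<in> hcar X \<Longrightarrow> (\<And>i. i \<in> F \<Longrightarrow> f i \<in> hcar X) \<Longrightarrow>
    hip X (sum f F) x = (\<Sum>i\<in>F. hip X (f i) x)"
  by (induction F rule: infinite_finite_induct) (auto simp: ip_add_left)

lemma ip_hsc_left: "x \<in> hcar X \<Longrightarrow> y \<in> hcar X \<Longrightarrow> hip X (hsc X c x) y = sc (cnj c) (hip X x y)"
  using st_ip[of y "hsc X c x"] by (simp add: hip_hsc_right st_sc st_ip)

text \<open>Definiteness as an extensionality principle. It yields linearity of maps that are known
  only through an adjoint relation.\<close>

lemma ip_ext:
  assumes "x \<in> hcar X" "y \<in> hcar X" "\<And>z. z \<in> hcar X \<Longrightarrow> hip X z x = hip X z y"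
  shows "x = y"
proof -
  have "hip X (x - y) (x - y) = 0"
    using assms by (simp add: ip_diff_right)
  then show ?thesis using assms hip_eq_0D[of "x - y"] by simp
qed

lemma hact_zero_right [simp]: "x \<in> hcar X \<Longrightarrow> hact X x 0 = 0"
  using hact_add_right[of x 0 0] by simp

lemma hnorm_nonneg [simp]: "hnorm X x \<ge> 0"
  by (simp add: hnorm_def)

lemma hnorm_zero [simp]: "hnorm X 0 = 0"
  by (simp add: hnorm_def)

lemma norm_hip_self: "norm (hip X x x) = (hnorm X x)\<^sup>2"
  by (simp add: hnorm_def)

lemma hnorm_minus: "x \<in> hcar X \<Longrightarrow> hnorm X (- x) = hnorm X x"
  by (simp add: hnorm_def ip_minus_left ip_minus_right)

lemma hnorm_minus_commute: "x \<in> hcar X \<Longrightarrow> y \<in> hcar X \<Longrightarrow> hnorm X (x - y) = hnorm X (y - x)"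
  using hnorm_minus[of "x - y"] by simp

lemma norm_hip_le: "x \<in> hcar X \<Longrightarrow> y \<in> hcar X \<Longrightarrow> norm (hip X x y) \<le> hnorm X x * hnorm X y"
  using Cauchy_Schwarz_sqrt by (simp add: hnorm_def)

lemma hnorm_triangle: "x \<in> hcar X \<Longrightarrow> y \<in> hcar X \<Longrightarrow> hnorm X (x + y) \<le> hnorm X x + hnorm X y"
  using triangle_ineq by (simp add: hnorm_def)

lemma hnorm_triangle_diff:
  assumes "x \<in> hcar X" "y \<in> hcar X" "z \<in> hcar X"
  shows "hnorm X (x - z) \<le> hnorm X (x - y) + hnorm X (y - z)"
  using hnorm_triangle[of "x - y" "y - z"] assms by simp

end

section \<open>The Hilbert module of square-summable functions\<close>

lemma XG_simps [simp]:
  "\<xi> \<in> hcar (XG X) \<longleftrightarrow> (\<forall>g. \<xi> g \<in> hcar X) \<and> (\<lambda>g. hip X (\<xi> g) (\<xi> g)) summable_on UNIV"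
  "hsc (XG X) c \<xi> = (\<lambda>g. hsc X c (\<xi> g))"
  "hact (XG X) \<xi> a = (\<lambda>g. hact X (\<xi> g) a)"
  "hip (XG X) \<xi> \<eta> = (\<Sum>\<^sub>\<infinity>g. hip X (\<xi> g) (\<eta> g))"
  by (simp_all add: XG_def)

context hilbert_module
begin

text \<open>Provides Cauchy-Schwarz and the triangle inequality on partial sums, with constants that
  do not depend on F.\<close>

lemma semi_inner_module_finite_sum:
  "semi_inner_module sc st {\<xi>. \<forall>g. \<xi> g \<in> hcar X} (\<lambda>\<xi> a g. hact X (\<xi> g) a)
     (\<lambda>\<xi> \<eta>. \<Sum>g\<in>F. hip X (\<xi> g) (\<eta> g))"
  by unfold_locales
     (auto simp: ip_add_right ip_act_right sum.distrib sum_distrib_right st_sum st_ip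
           intro!: pos_cone_sum ip_pos)

text \<open>Off a suitable finite set, a partial sum of mixed terms is at most the geometric mean of
  the two diagonal ones, both of which are smaller than e.\<close>

lemma summable_on_hip:
  assumes \<xi>: "\<xi> \<in> hcar (XG X)" and \<eta>: "\<eta> \<in> hcar (XG X)"
  shows "(\<lambda>g. hip X (\<xi> g) (\<eta> g)) summable_on UNIV"
  unfolding summable_on_iff_Cauchy
proof (intro allI impI)
  fix e :: real assume "e > 0"
  have "(\<lambda>g. hip X (\<xi> g) (\<xi> g)) summable_on UNIV" "(\<lambda>g. hip X (\<eta> g) (\<eta> g)) summable_on UNIV"
    using assms by auto
  then obtain F1 F2 where F:
      "finite F1" "\<forall>F. finite F \<and> F \<subseteq> UNIV - F1 \<longrightarrow> norm (\<Sum>g\<in>F. hip X (\<xi> g) (\<xi> g)) < e"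
      "finite F2" "\<forall>F. finite F \<and> F \<subseteq> UNIV - F2 \<longrightarrow> norm (\<Sum>g\<in>F. hip X (\<eta> g) (\<eta> g)) < e"
    using \<open>e > 0\<close> unfolding summable_on_iff_Cauchy by metis
  have "norm (\<Sum>g\<in>F. hip X (\<xi> g) (\<eta> g)) < e" if F': "finite F \<and> F \<subseteq> UNIV - (F1 \<union> F2)" for F
  proof -
    interpret fin: semi_inner_module sc st "{\<xi>. \<forall>g. \<xi> g \<in> hcar X}" "\<lambda>\<xi> a g. hact X (\<xi> g) a"
        "\<lambda>\<xi> \<eta>. \<Sum>g\<in>F. hip X (\<xi> g) (\<eta> g)"
      by (rule semi_inner_module_finite_sum)
    have "(norm (\<Sum>g\<in>F. hip X (\<xi> g) (\<eta> g)))\<^sup>2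
        \<le> norm (\<Sum>g\<in>F. hip X (\<xi> g) (\<xi> g)) * norm (\<Sum>g\<in>F. hip X (\<eta> g) (\<eta> g))"
      using assms by (intro fin.Cauchy_Schwarz) auto
    also have "\<dots> < e * e"
      using F(2,4) F' by (intro mult_strict_mono') auto
    finally show ?thesis
      using \<open>e > 0\<close> by (intro power2_less_imp_less[of _ e]) (auto simp: power2_eq_square)
  qed
  then show "\<exists>F0. finite F0 \<and> F0 \<subseteq> UNIV \<and>
      (\<forall>F. finite F \<and> F \<subseteq> UNIV - F0 \<longrightarrow> norm (\<Sum>g\<in>F. hip X (\<xi> g) (\<eta> g)) < e)"
    using F(1,3) by (intro exI[of _ "F1 \<union> F2"]) auto
qed

lemma XG_add_mem:
  assumes "\<xi> \<in> hcar (XG X)" "\<eta> \<in> hcar (XG X)"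
  shows "\<xi> + \<eta> \<in> hcar (XG X)"
proof -
  have "(\<lambda>g. (hip X (\<xi> g) (\<xi> g) + hip X (\<eta> g) (\<xi> g)) + (hip X (\<xi> g) (\<eta> g) + hip X (\<eta> g) (\<eta> g)))
      summable_on UNIV"
    using assms by (intro summable_on_add summable_on_hip)
  then show ?thesis using assms by (simp add: ip_add_left ip_add_right add.assoc)
qed

lemma XG_hact_mem:
  assumes "\<xi> \<in> hcar (XG X)"
  shows "(\<lambda>g. hact X (\<xi> g) a) \<in> hcar (XG X)"
proof -
  have "(\<lambda>g. st a * hip X (\<xi> g) (\<xi> g) * a) summable_on UNIV"
    using assms by (intro summable_on_cmult_left summable_on_cmult_right) auto
  then show ?thesis using assms by (simp add: ip_act_left ip_act_right mult.assoc)
qed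

lemma XG_hsc_mem:
  assumes "\<xi> \<in> hcar (XG X)"
  shows "(\<lambda>g. hsc X c (\<xi> g)) \<in> hcar (XG X)"
proof -
  have "(\<lambda>g. sc c (sc (cnj c) (hip X (\<xi> g) (\<xi> g)))) summable_on UNIV"
    using assms by (intro summable_on_bounded_linear[OF bounded_linear_sc]) auto
  then show ?thesis using assms by (simp add: hip_hsc_right ip_hsc_left)
qed

lemma hnorm_XG_leI:
  assumes \<xi>: "\<xi> \<in> hcar (XG X)" and "e \<ge> 0"
    and le: "\<And>F. finite F \<Longrightarrow> sqrt (norm (\<Sum>g\<in>F. hip X (\<xi> g) (\<xi> g))) \<le> e"
  shows "hnorm (XG X) \<xi> \<le> e"
proof -
  have "(sum (\<lambda>g. hip X (\<xi> g) (\<xi> g)) \<longlongrightarrow> hip (XG X) \<xi> \<xi>) (finite_subsets_at_top UNIV)"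
    using \<xi> has_sum_infsum unfolding has_sum_def by fastforce
  then have "norm (hip (XG X) \<xi> \<xi>) \<le> e\<^sup>2"
  proof (rule Lim_norm_ubound[rotated])
    show "\<forall>\<^sub>F F in finite_subsets_at_top UNIV. norm (\<Sum>g\<in>F. hip X (\<xi> g) (\<xi> g)) \<le> e\<^sup>2"
      using le by (intro eventually_finite_subsets_at_top_weakI) (simp add: sqrt_le_D)
  qed simp
  then show ?thesis unfolding hnorm_def using \<open>e \<ge> 0\<close> by (intro real_le_lsqrt) auto
qed

lemma sqrt_norm_sum_le_hnorm_XG:
  assumes "\<xi> \<in> hcar (XG X)" "finite F"
  shows "sqrt (norm (\<Sum>g\<in>F. hip X (\<xi> g) (\<xi> g))) \<le> hnorm (XG X) \<xi>"
  unfolding hnorm_def XG_simps using assms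
  by (intro real_sqrt_le_mono norm_sum_le_norm_infsum) (auto intro: ip_pos)

text \<open>A crude bound that suffices on a fixed finite set, where pointwise convergence then
  implies convergence in the seminorm of the partial sum.\<close>

lemma sqrt_norm_sum_le_sum_hnorm:
  "sqrt (norm (\<Sum>g\<in>F. hip X (\<xi> g) (\<xi> g))) \<le> (\<Sum>g\<in>F. hnorm X (\<xi> g))"
proof -
  have "norm (\<Sum>g\<in>F. hip X (\<xi> g) (\<xi> g)) \<le> (\<Sum>g\<in>F. (hnorm X (\<xi> g))\<^sup>2)"
    by (rule order_trans[OF norm_sum]) (simp add: norm_hip_self)
  then have "sqrt (norm (\<Sum>g\<in>F. hip X (\<xi> g) (\<xi> g))) \<le> L2_set (\<lambda>g. hnorm X (\<xi> g)) F"
    unfolding L2_set_def by (rule real_sqrt_le_mono)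
  also have "\<dots> \<le> (\<Sum>g\<in>F. hnorm X (\<xi> g))" by (rule L2_set_le_sum) simp
  finally show ?thesis .
qed

text \<open>The argument for square-summable sequences, with the seminorms \<open>?n F\<close> of
  partial sums in place of the norm: pointwise limits, then an estimate uniform in F, then passage
  to the whole group.\<close>

lemma XG_complete:
  fixes s :: "nat \<Rightarrow> 'g \<Rightarrow> 'x"
  assumes s: "\<And>n. s n \<in> hcar (XG X)"
    and Cauchy: "\<And>e. e > 0 \<Longrightarrow> \<exists>N. \<forall>m\<ge>N. \<forall>n\<ge>N. hnorm (XG X) (s m - s n) < e"
  shows "\<exists>l\<in>hcar (XG X). \<forall>e>0. \<exists>N. \<forall>n\<ge>N. hnorm (XG X) (s n - l) < e"
proof -
  let ?n = "\<lambda>F \<xi>. sqrt (norm (\<Sum>g\<in>F. hip X (\<xi> g) (\<xi> g)))"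
  have sX: "s n g \<in> hcar X" for n g using s by simp
  have neg: "- \<xi> \<in> hcar (XG X)" if "\<xi> \<in> hcar (XG X)" for \<xi> :: "'g \<Rightarrow> 'x"
    using that by (simp add: ip_minus_left ip_minus_right)
  have diff: "\<xi> - \<eta> \<in> hcar (XG X)" if "\<xi> \<in> hcar (XG X)" "\<eta> \<in> hcar (XG X)" for \<xi> \<eta> :: "'g \<Rightarrow> 'x"
    using XG_add_mem[OF that(1) neg[OF that(2)]] by (simp only: add_uminus_conv_diff)
  have tri: "?n F (\<xi> + \<eta>) \<le> ?n F \<xi> + ?n F \<eta>"
    if "\<And>g. \<xi> g \<in> hcar X" "\<And>g. \<eta> g \<in> hcar X" for F :: "'g set" and \<xi> \<eta>
  proof -
    interpret fin: semi_inner_module sc st "{\<xi>. \<forall>g. \<xi> g \<in> hcar X}" "\<lambda>\<xi> a g. hact X (\<xi> g) a"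
        "\<lambda>\<xi> \<eta>. \<Sum>g\<in>F. hip X (\<xi> g) (\<eta> g)"
      by (rule semi_inner_module_finite_sum)
    show ?thesis using that by (intro fin.triangle_ineq) auto
  qed
  have "\<exists>l\<in>hcar X. (\<lambda>n. hnorm X (s n g - l)) \<longlonglongrightarrow> 0" for g
  proof -
    have "\<exists>N. \<forall>m\<ge>N. \<forall>n\<ge>N. hnorm X (s m g - s n g) < e" if "e > 0" for e
    proof -
      have "hnorm X (s m g - s n g) \<le> hnorm (XG X) (s m - s n)" for m n
        using sqrt_norm_sum_le_hnorm_XG[OF diff[OF s s], of "{g}" m n] by (simp add: hnorm_def)
      then show ?thesis using Cauchy[OF \<open>e > 0\<close>] by (meson le_less_trans)
    qed
    then obtain l where "l \<in> hcar X" "\<And>e. e > 0 \<Longrightarrow> \<exists>N. \<forall>n\<ge>N. hnorm X (s n g - l) < e"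
      using complete[of "\<lambda>n. s n g"] sX by blast
    then show ?thesis by (auto intro!: bexI[of _ l] simp: LIMSEQ_iff)
  qed
  then obtain l where l: "\<And>g. l g \<in> hcar X" "\<And>g. (\<lambda>n. hnorm X (s n g - l g)) \<longlonglongrightarrow> 0"
    by metis
  \<comment> \<open>N comes from the Cauchy condition alone and is the same for all F. Only the
    auxiliary index \<open>m\<close> depends on F, and it does not occur in the resulting
    bound.\<close>
  have unif: "\<exists>N. \<forall>n\<ge>N. \<forall>F. finite F \<longrightarrow> ?n F (s n - l) \<le> e" if "e > 0" for e
  proof -
    obtain N where N: "\<forall>m\<ge>N. \<forall>n\<ge>N. hnorm (XG X) (s m - s n) < e/2"
      using Cauchy[of "e/2"] \<open>e > 0\<close> by auto
    have "?n F (s n - l) \<le> e" if "n \<ge> N" "finite F" for n F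
    proof -
      have "(\<lambda>m. \<Sum>g\<in>F. hnorm X (s m g - l g)) \<longlonglongrightarrow> (\<Sum>g\<in>F. 0)"
        by (intro tendsto_sum l)
      then have "\<forall>\<^sub>F m in sequentially. (\<Sum>g\<in>F. hnorm X (s m g - l g)) < e/2"
        using \<open>e > 0\<close> by (intro order_tendstoD) auto
      then obtain M where M: "\<And>m. m \<ge> M \<Longrightarrow> (\<Sum>g\<in>F. hnorm X (s m g - l g)) < e/2"
        unfolding eventually_sequentially by blast
      define m where "m = max M N"
      have "?n F (s n - l) = ?n F ((s n - s m) + (s m - l))" by simp
      also have "\<dots> \<le> ?n F (s n - s m) + ?n F (s m - l)"
        using sX l(1) by (intro tri) auto
      also have "?n F (s n - s m) \<le> hnorm (XG X) (s n - s m)"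
        by (intro sqrt_norm_sum_le_hnorm_XG diff s that)
      also have "\<dots> < e/2" using N that by (simp add: m_def)
      also have "?n F (s m - l) \<le> (\<Sum>g\<in>F. hnorm X ((s m - l) g))"
        by (rule sqrt_norm_sum_le_sum_hnorm)
      also have "\<dots> < e/2" using M[of m] by (simp add: m_def)
      finally show ?thesis by simp
    qed
    then show ?thesis by blast
  qed
  have lXG: "l \<in> hcar (XG X)"
  proof -
    have "(\<lambda>g. hip X (l g) (l g)) summable_on UNIV"
      unfolding summable_on_iff_Cauchy
    proof (intro allI impI)
      fix e :: real assume "e > 0"
      \<comment> \<open>The seminorms are square roots, so two contributions of size
        \<open>d\<close> add up to \<open>sqrt e\<close>.\<close>
      define d where "d = sqrt e / 2"
      have d: "d > 0" using \<open>e > 0\<close> by (simp add: d_def)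
      obtain N where N: "\<forall>n\<ge>N. \<forall>F. finite F \<longrightarrow> ?n F (s n - l) \<le> d"
        using unif[OF d] by blast
      have "(\<lambda>g. hip X (s N g) (s N g)) summable_on UNIV" using s by simp
      then obtain F0 where F0: "finite F0"
          "\<forall>F. finite F \<and> F \<subseteq> UNIV - F0 \<longrightarrow> norm (\<Sum>g\<in>F. hip X (s N g) (s N g)) < d\<^sup>2"
        using d unfolding summable_on_iff_Cauchy by (metis zero_less_power)
      have "norm (\<Sum>g\<in>F. hip X (l g) (l g)) < e" if F: "finite F \<and> F \<subseteq> UNIV - F0" for F
      proof -
        have "?n F l = ?n F (s N + - (s N - l))" by simp
        also have "\<dots> \<le> ?n F (s N) + ?n F (- (s N - l))"
          using sX l(1) by (intro tri) auto
        also have "?n F (- (s N - l)) = ?n F (s N - l)"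
          using sX l(1) by (simp add: ip_diff_left ip_diff_right algebra_simps)
        also have "\<dots> \<le> d" using N F by simp
        also have "?n F (s N) < sqrt (d\<^sup>2)" using F0(2) F by (intro real_sqrt_less_mono) auto
        finally have "?n F l < sqrt e" using d by (simp add: d_def)
        then show ?thesis by simp
      qed
      then show "\<exists>F0. finite F0 \<and> F0 \<subseteq> UNIV \<and>
          (\<forall>F. finite F \<and> F \<subseteq> UNIV - F0 \<longrightarrow> norm (\<Sum>g\<in>F. hip X (l g) (l g)) < e)"
        using F0(1) by auto
    qed
    then show ?thesis using l(1) by simp
  qed
  have "\<exists>N. \<forall>n\<ge>N. hnorm (XG X) (s n - l) < e" if "e > 0" for e
  proof -
    obtain N where N: "\<forall>n\<ge>N. \<forall>F. finite F \<longrightarrow> ?n F (s n - l) \<le> e/2"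
      using unif[of "e/2"] \<open>e > 0\<close> by auto
    have "hnorm (XG X) (s n - l) < e" if "n \<ge> N" for n
    proof -
      have "hnorm (XG X) (s n - l) \<le> e/2"
        using N that \<open>e > 0\<close> by (intro hnorm_XG_leI diff s lXG) auto
      then show ?thesis using \<open>e > 0\<close> by simp
    qed
    then show ?thesis by blast
  qed
  then show ?thesis using lXG by blast
qed

lemma is_hmod_XG: "is_hmod sc st (XG X :: ('g \<Rightarrow> 'x, 'a) hmod)"
proof -
  let ?Y = "XG X :: ('g \<Rightarrow> 'x, 'a) hmod"
  have pos: "pos_cone (hip ?Y \<xi> \<xi>)" if "\<xi> \<in> hcar ?Y" for \<xi>
    using that by (auto intro!: pos_cone_infsum ip_pos)
  have herm: "hip ?Y \<eta> \<xi> = st (hip ?Y \<xi> \<eta>)" if "\<xi> \<in> hcar ?Y" "\<eta> \<in> hcar ?Y" for \<xi> \<eta>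
  proof -
    have "(\<Sum>\<^sub>\<infinity>g. st (hip X (\<xi> g) (\<eta> g))) = st (\<Sum>\<^sub>\<infinity>g. hip X (\<xi> g) (\<eta> g))"
      by (rule infsumI[OF has_sum_bounded_linear[OF bounded_linear_st has_sum_infsum[OF summable_on_hip[OF that]]]])
    then show ?thesis using that by (simp add: st_ip)
  qed
  have iphsc: "hip ?Y \<xi> (hsc ?Y c \<eta>) = sc c (hip ?Y \<xi> \<eta>)" if "\<xi> \<in> hcar ?Y" "\<eta> \<in> hcar ?Y" for \<xi> \<eta> c
  proof -
    have "(\<Sum>\<^sub>\<infinity>g. sc c (hip X (\<xi> g) (\<eta> g))) = sc c (\<Sum>\<^sub>\<infinity>g. hip X (\<xi> g) (\<eta> g))"
      by (rule infsumI[OF has_sum_bounded_linear[OF bounded_linear_sc has_sum_infsum[OF summable_on_hip[OF that]]]])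
    then show ?thesis using that by (simp add: hip_hsc_right)
  qed
  have ipact: "hip ?Y \<xi> (hact ?Y \<eta> a) = hip ?Y \<xi> \<eta> * a" if "\<xi> \<in> hcar ?Y" "\<eta> \<in> hcar ?Y" for \<xi> \<eta> a
  proof -
    have "(\<Sum>\<^sub>\<infinity>g. hip X (\<xi> g) (\<eta> g) * a) = (\<Sum>\<^sub>\<infinity>g. hip X (\<xi> g) (\<eta> g)) * a"
      by (rule infsum_cmult_left) (rule summable_on_hip[OF that])
    then show ?thesis using that by (simp add: ip_act_right)
  qed
  have ipadd: "hip ?Y \<xi> (\<eta> + \<zeta>) = hip ?Y \<xi> \<eta> + hip ?Y \<xi> \<zeta>"
    if "\<xi> \<in> hcar ?Y" "\<eta> \<in> hcar ?Y" "\<zeta> \<in> hcar ?Y" for \<xi> \<eta> \<zeta>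
  proof -
    have "(\<Sum>\<^sub>\<infinity>g. hip X (\<xi> g) (\<eta> g) + hip X (\<xi> g) (\<zeta> g)) = hip ?Y \<xi> \<eta> + hip ?Y \<xi> \<zeta>"
      unfolding XG_simps by (rule infsum_add; rule summable_on_hip) (rule that)+
    then show ?thesis using that by (simp add: ip_add_right)
  qed
  have def0: "\<xi> = 0" if \<xi>: "\<xi> \<in> hcar ?Y" "hip ?Y \<xi> \<xi> = 0" for \<xi>
  proof
    fix g
    have "norm (\<Sum>g\<in>{g}. hip X (\<xi> g) (\<xi> g)) \<le> norm (hip ?Y \<xi> \<xi>)"
      unfolding XG_simps using \<xi> by (intro norm_sum_le_norm_infsum) (auto intro: ip_pos)
    then show "\<xi> g = 0 g" using \<xi> by (auto intro: hip_eq_0D)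
  qed
  have minus: "- \<xi> \<in> hcar ?Y" if "\<xi> \<in> hcar ?Y" for \<xi>
    using that by (simp add: ip_minus_left ip_minus_right)
  show ?thesis
    unfolding is_hmod_def positive_el_iff_pos_cone
    apply (intro conjI ballI allI impI)
    subgoal by simp
    subgoal by (rule XG_add_mem)
    subgoal by (rule minus)
    subgoal unfolding XG_simps(2) by (rule XG_hsc_mem)
    subgoal unfolding XG_simps(3) by (rule XG_hact_mem)
    subgoal by (rule ext) (simp add: hsc_add_right)
    subgoal by (rule ext) (simp add: hsc_add_left)
    subgoal by (rule ext) (simp add: hsc_hsc)
    subgoal by (rule ext) simp
    subgoal by (rule ext) (simp add: hact_add_left)
    subgoal by (rule ext) (simp add: hact_add_right)
    subgoal by (rule ext) (simp add: hact_mult)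
    subgoal by (rule ext) simp
    subgoal by (rule ext) (simp add: hact_hsc)
    subgoal by (rule ext) (simp add: hact_sc)
    subgoal by (rule ipadd)
    subgoal by (rule iphsc)
    subgoal by (rule ipact)
    subgoal by (rule herm)
    subgoal by (rule pos)
    subgoal by (rule def0)
    subgoal by (rule XG_complete) auto
    done
qed

end

section \<open>Unitary extension of isometric families\<close>

lemma (in hilbert_module) norm_hip_diff_le:
  assumes "x \<in> hcar X" "y \<in> hcar X" "x' \<in> hcar X" "y' \<in> hcar X"
    and "hnorm X (x - x') \<le> e" "hnorm X (y - y') \<le> e" "e \<le> 1"
  shows "norm (hip X x y - hip X x' y') \<le> e * (hnorm X x + hnorm X y + 1)"
proof -
  have e: "e \<ge> 0" using assms(5) hnorm_nonneg order_trans by blast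
  have "hnorm X x' \<le> hnorm X (x' - x) + hnorm X x"
    using hnorm_triangle[of "x' - x" x] assms by simp
  also have "hnorm X (x' - x) \<le> 1"
    using assms hnorm_minus_commute[of x' x] by simp
  finally have x': "hnorm X x' \<le> hnorm X x + 1" by simp
  have "hip X x y - hip X x' y' = hip X (x - x') y + hip X x' (y - y')"
    using assms by (simp add: ip_diff_left ip_diff_right)
  also have "norm \<dots> \<le> hnorm X (x - x') * hnorm X y + hnorm X x' * hnorm X (y - y')"
    using assms by (intro order_trans[OF norm_triangle_ineq] add_mono norm_hip_le) auto
  also have "\<dots> \<le> e * hnorm X y + (hnorm X x + 1) * e"
    using assms x' e by (intro add_mono mult_mono) auto
  also have "\<dots> = e * (hnorm X x + hnorm X y + 1)" by (simp add: algebra_simps)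
  finally show ?thesis .
qed

text \<open>The graph of the isometry that extends \<open>a j \<mapsto> b j\<close>. Working with the graph keeps the
  construction symmetric in the two modules, so that inverting it costs nothing.\<close>

definition simul_approx ::
  "'j set \<Rightarrow> ('j \<Rightarrow> 't::ab_group_add) \<Rightarrow> ('j \<Rightarrow> 'y::ab_group_add) \<Rightarrow>
   ('t, 'a::real_normed_vector) hmod \<Rightarrow> ('y, 'a) hmod \<Rightarrow> 't \<Rightarrow> 'y \<Rightarrow> bool" where
  "simul_approx J a b T Y t y \<longleftrightarrow> t \<in> hcar T \<and> y \<in> hcar Y \<and>
     (\<forall>e>0. \<exists>I k. finite (I::nat set) \<and> k ` I \<subseteq> J \<and>
        hnorm T (t - (\<Sum>i\<in>I. a (k i))) < e \<and> hnorm Y (y - (\<Sum>i\<in>I. b (k i))) < e)"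

lemma simul_approx_sym: "simul_approx J a b T Y t y \<Longrightarrow> simul_approx J b a Y T y t"
  unfolding simul_approx_def by meson

text \<open>Approximants are sums without coefficients, as in \<open>internal_tensor\<close>: for
  elementary tensors a scalar can be absorbed into one of the factors.\<close>

locale isometric_families = cstar sc st + T: hilbert_module sc st T + Y: hilbert_module sc st Y
  for sc :: "complex \<Rightarrow> 'a::{real_normed_algebra_1,banach} \<Rightarrow> 'a" and st :: "'a \<Rightarrow> 'a"
    and T :: "('t::ab_group_add, 'a) hmod" and Y :: "('y::ab_group_add, 'a) hmod" +
  fixes J :: "'j set" and a :: "'j \<Rightarrow> 't" and b :: "'j \<Rightarrow> 'y"
  assumes a_mem: "j \<in> J \<Longrightarrow> a j \<in> hcar T" and b_mem: "j \<in> J \<Longrightarrow> b j \<in> hcar Y"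
    and hip_eq: "i \<in> J \<Longrightarrow> j \<in> J \<Longrightarrow> hip T (a i) (a j) = hip Y (b i) (b j)"
    and a_dense: "t \<in> hcar T \<Longrightarrow> e > 0 \<Longrightarrow>
      \<exists>I k. finite (I::nat set) \<and> k ` I \<subseteq> J \<and> hnorm T (t - (\<Sum>i\<in>I. a (k i))) < e"
    and b_dense: "y \<in> hcar Y \<Longrightarrow> e > 0 \<Longrightarrow>
      \<exists>I k. finite (I::nat set) \<and> k ` I \<subseteq> J \<and> hnorm Y (y - (\<Sum>i\<in>I. b (k i))) < e"
begin

abbreviation "graph \<equiv> simul_approx J a b T Y"

lemma hip_sums_eq:
  assumes "k ` I \<subseteq> J" "k' ` I' \<subseteq> J"
  shows "hip T (\<Sum>i\<in>I. a (k i)) (\<Sum>i\<in>I'. a (k' i)) = hip Y (\<Sum>i\<in>I. b (k i)) (\<Sum>i\<in>I'. b (k' i))"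
proof -
  have "hip T (\<Sum>i\<in>I. a (k i)) (\<Sum>i\<in>I'. a (k' i)) = (\<Sum>i\<in>I. \<Sum>i'\<in>I'. hip T (a (k i)) (a (k' i')))"
    using assms by (subst T.ip_sum_left) (auto simp: T.ip_sum_right image_subset_iff a_mem)
  also have "\<dots> = (\<Sum>i\<in>I. \<Sum>i'\<in>I'. hip Y (b (k i)) (b (k' i')))"
    using assms by (intro sum.cong refl hip_eq) auto
  also have "\<dots> = hip Y (\<Sum>i\<in>I. b (k i)) (\<Sum>i\<in>I'. b (k' i))"
    using assms by (subst Y.ip_sum_left) (auto simp: Y.ip_sum_right image_subset_iff b_mem)
  finally show ?thesis .
qed

lemma hnorm_sums_diff_eq:
  assumes "k ` I \<subseteq> J" "k' ` I' \<subseteq> J"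
  shows "hnorm T ((\<Sum>i\<in>I. a (k i)) - (\<Sum>i\<in>I'. a (k' i)))
       = hnorm Y ((\<Sum>i\<in>I. b (k i)) - (\<Sum>i\<in>I'. b (k' i)))"
proof -
  have "(\<Sum>i\<in>I. a (k i)) \<in> hcar T" "(\<Sum>i\<in>I'. a (k' i)) \<in> hcar T"
       "(\<Sum>i\<in>I. b (k i)) \<in> hcar Y" "(\<Sum>i\<in>I'. b (k' i)) \<in> hcar Y"
    using assms by (auto intro!: T.sum_mem Y.sum_mem simp: image_subset_iff a_mem b_mem)
  then show ?thesis
    unfolding hnorm_def
    by (simp add: T.ip_diff_left T.ip_diff_right Y.ip_diff_left Y.ip_diff_right hip_sums_eq assms)
qed

text \<open>Take sums \<open>A n\<close> tending to \<open>t\<close>. Equal Gram matrices make the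
  matching sums \<open>B n\<close> Cauchy, and completeness of \<open>Y\<close> supplies the partner
  of \<open>t\<close>.\<close>

lemma graph_total:
  assumes t: "t \<in> hcar T"
  shows "\<exists>y. graph t y"
proof -
  have "\<exists>I k. finite (I::nat set) \<and> k ` I \<subseteq> J \<and> hnorm T (t - (\<Sum>i\<in>I. a (k i))) < 1 / Suc n" for n
    using t by (intro a_dense) auto
  then obtain I k where Ik: "\<And>n. finite (I n :: nat set)" "\<And>n. k n ` I n \<subseteq> J"
      "\<And>n. hnorm T (t - (\<Sum>i\<in>I n. a (k n i))) < 1 / Suc n"
    by metis
  define A where "A n = (\<Sum>i\<in>I n. a (k n i))" for n
  define B where "B n = (\<Sum>i\<in>I n. b (k n i))" for n
  have A: "A n \<in> hcar T" and B: "B n \<in> hcar Y" for n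
    unfolding A_def B_def using Ik(2)
    by (auto intro!: T.sum_mem Y.sum_mem a_mem b_mem simp: image_subset_iff)
  have small: "\<exists>N. \<forall>n\<ge>N. hnorm T (t - A n) < e" if "e > 0" for e
  proof -
    obtain N where N: "1 / Suc N < e" using \<open>e > 0\<close> nat_approx_posE by blast
    have "hnorm T (t - A n) < e" if "n \<ge> N" for n
    proof -
      have "hnorm T (t - A n) < 1 / Suc n" unfolding A_def by (rule Ik)
      also have "\<dots> \<le> 1 / Suc N" using that by (intro divide_left_mono) auto
      finally show ?thesis using N by simp
    qed
    then show ?thesis by blast
  qed
  have "\<exists>N. \<forall>m\<ge>N. \<forall>n\<ge>N. hnorm Y (B m - B n) < e" if "e > 0" for e
  proof -
    obtain N where N: "\<forall>n\<ge>N. hnorm T (t - A n) < e/2" using small[of "e/2"] \<open>e > 0\<close> by auto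
    have "hnorm Y (B m - B n) < e" if "m \<ge> N" "n \<ge> N" for m n
    proof -
      have "hnorm Y (B m - B n) = hnorm T (A m - A n)"
        unfolding A_def B_def by (rule hnorm_sums_diff_eq[symmetric]; rule Ik)
      also have "\<dots> \<le> hnorm T (A m - t) + hnorm T (t - A n)"
        using A t by (intro T.hnorm_triangle_diff)
      also have "hnorm T (A m - t) = hnorm T (t - A m)"
        using A t by (intro T.hnorm_minus_commute)
      finally have "hnorm Y (B m - B n) \<le> hnorm T (t - A m) + hnorm T (t - A n)" .
      moreover have "hnorm T (t - A m) < e/2" "hnorm T (t - A n) < e/2" using N that by auto
      ultimately show ?thesis by linarith
    qed
    then show ?thesis by blast
  qed
  then obtain y where y: "y \<in> hcar Y" "\<And>e. e > 0 \<Longrightarrow> \<exists>N. \<forall>n\<ge>N. hnorm Y (B n - y) < e"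
    using Y.complete[of B] B by blast
  have "\<exists>I k. finite (I::nat set) \<and> k ` I \<subseteq> J \<and>
        hnorm T (t - (\<Sum>i\<in>I. a (k i))) < e \<and> hnorm Y (y - (\<Sum>i\<in>I. b (k i))) < e"
    if "e > 0" for e
  proof -
    obtain M N where "\<forall>n\<ge>M. hnorm T (t - A n) < e" "\<forall>n\<ge>N. hnorm Y (B n - y) < e"
      using small[OF \<open>e > 0\<close>] y(2)[OF \<open>e > 0\<close>] by blast
    then have "hnorm T (t - A (max M N)) < e" "hnorm Y (B (max M N) - y) < e" by auto
    then show ?thesis
      using Ik(1,2)[of "max M N"] Y.hnorm_minus_commute[OF B y(1)]
      by (intro exI[of _ "I (max M N)"] exI[of _ "k (max M N)"]) (simp add: A_def B_def)
  qed
  then show ?thesis unfolding simul_approx_def using t y by blast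
qed

text \<open>Inner products agree on matching sums, and both sides depend continuously on the
  approximants.\<close>

lemma graph_hip:
  assumes "graph t y" "graph t' y'"
  shows "hip T t t' = hip Y y y'"
proof -
  have mem: "t \<in> hcar T" "t' \<in> hcar T" "y \<in> hcar Y" "y' \<in> hcar Y"
    using assms unfolding simul_approx_def by auto
  let ?K = "(hnorm T t + hnorm T t' + 1) + (hnorm Y y + hnorm Y y' + 1)"
  have K: "?K > 0" by (simp add: add_pos_nonneg add_nonneg_pos)
  \<comment> \<open>The restriction to \<open>e \<le> 1\<close> bounds the norms of the
    approximants, so that \<open>?K\<close> involves only the four given vectors.\<close>
  have bound: "norm (hip T t t' - hip Y y y') \<le> e * ?K" if e: "e > 0" "e \<le> 1" for e
  proof -
    obtain I k where 1: "finite (I::nat set)" "k ` I \<subseteq> J"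
        "hnorm T (t - (\<Sum>i\<in>I. a (k i))) < e" "hnorm Y (y - (\<Sum>i\<in>I. b (k i))) < e"
      using assms(1) e unfolding simul_approx_def by metis
    obtain I' k' where 2: "finite (I'::nat set)" "k' ` I' \<subseteq> J"
        "hnorm T (t' - (\<Sum>i\<in>I'. a (k' i))) < e" "hnorm Y (y' - (\<Sum>i\<in>I'. b (k' i))) < e"
      using assms(2) e unfolding simul_approx_def by metis
    let ?A = "\<Sum>i\<in>I. a (k i)" and ?A' = "\<Sum>i\<in>I'. a (k' i)"
      and ?B = "\<Sum>i\<in>I. b (k i)" and ?B' = "\<Sum>i\<in>I'. b (k' i)"
    have m: "?A \<in> hcar T" "?A' \<in> hcar T" "?B \<in> hcar Y" "?B' \<in> hcar Y"
      using 1 2 by (auto intro!: T.sum_mem Y.sum_mem simp: image_subset_iff a_mem b_mem)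
    have "hip T ?A ?A' = hip Y ?B ?B'" by (rule hip_sums_eq[OF 1(2) 2(2)])
    then have "norm (hip T t t' - hip Y y y')
        = norm ((hip T t t' - hip T ?A ?A') - (hip Y y y' - hip Y ?B ?B'))" by simp
    also have "\<dots> \<le> norm (hip T t t' - hip T ?A ?A') + norm (hip Y y y' - hip Y ?B ?B')"
      by (rule norm_triangle_ineq4)
    also have "\<dots> \<le> e * (hnorm T t + hnorm T t' + 1) + e * (hnorm Y y + hnorm Y y' + 1)"
      using 1 2 mem m e by (intro add_mono T.norm_hip_diff_le Y.norm_hip_diff_le) auto
    finally show ?thesis by (simp add: algebra_simps)
  qed
  have "norm (hip T t t' - hip Y y y') \<le> 0"
  proof (rule field_le_epsilon)
    fix d :: real assume "d > 0"
    have "norm (hip T t t' - hip Y y y') \<le> min 1 (d / ?K) * ?K"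
      using \<open>d > 0\<close> K by (intro bound) auto
    also have "\<dots> \<le> d / ?K * ?K" using K by (intro mult_right_mono) auto
    finally show "norm (hip T t t' - hip Y y y') \<le> 0 + d" using K by simp
  qed
  then show ?thesis by simp
qed

text \<open>All four inner products between \<open>y\<close> and \<open>y'\<close> equal
  \<open>hip T t t\<close>, so their difference has length 0.\<close>

lemma graph_unique:
  assumes "graph t y" "graph t y'"
  shows "y = y'"
proof -
  have mem: "y \<in> hcar Y" "y' \<in> hcar Y" using assms unfolding simul_approx_def by auto
  have "hip Y y y = hip T t t" "hip Y y y' = hip T t t" "hip Y y' y = hip T t t" "hip Y y' y' = hip T t t"
    using assms by (auto intro: graph_hip[symmetric])
  then have "hip Y (y - y') (y - y') = 0"
    using mem by (simp add: Y.ip_diff_left Y.ip_diff_right)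
  then show ?thesis using mem Y.hip_eq_0D[of "y - y'"] by simp
qed

lemma graph_family:
  assumes "j \<in> J"
  shows "graph (a j) (b j)"
  unfolding simul_approx_def
proof (intro conjI allI impI)
  show "\<exists>I k. finite (I::nat set) \<and> k ` I \<subseteq> J \<and>
      hnorm T (a j - (\<Sum>i\<in>I. a (k i))) < e \<and> hnorm Y (b j - (\<Sum>i\<in>I. b (k i))) < e"
    if "e > 0" for e
    using that assms by (intro exI[of _ "{0}"] exI[of _ "\<lambda>_. j"]) auto
qed (use assms in \<open>auto intro: a_mem b_mem\<close>)

lemma isometric_families_swap: "isometric_families sc st Y T J b a"
  by unfold_locales (rule a_mem b_mem a_dense b_dense hip_eq[symmetric]; assumption)+

text \<open>\<open>W\<close> and \<open>S\<close> select from the same graph read in the two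
  directions. Hence \<open>graph_hip\<close> is the adjoint relation between them, and uniqueness on
  either side makes them mutually inverse.\<close>

lemma unitary_extension: "\<exists>W. unitary_op T Y W \<and> (\<forall>j\<in>J. W (a j) = b j)"
proof -
  interpret swap: isometric_families sc st Y T J b a by (rule isometric_families_swap)
  have sym: "swap.graph y t \<longleftrightarrow> graph t y" for y t using simul_approx_sym by metis
  obtain W where W: "\<And>t. t \<in> hcar T \<Longrightarrow> graph t (W t)" using graph_total by metis
  obtain S where S: "\<And>y. y \<in> hcar Y \<Longrightarrow> graph (S y) y" using swap.graph_total sym by metis
  have Wm: "W t \<in> hcar Y" if "t \<in> hcar T" for t
    using W[OF that] unfolding simul_approx_def by auto
  have Sm: "S y \<in> hcar T" if "y \<in> hcar Y" for y
    using S[OF that] unfolding simul_approx_def by auto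
  have "unitary_op T Y W"
    unfolding unitary_op_def
  proof (intro conjI exI[of _ S] ballI)
    show "hip Y (W x) y = hip T x (S y)" if "x \<in> hcar T" "y \<in> hcar Y" for x y
      by (rule graph_hip[OF W S, symmetric]) (rule that)+
    show "S (W x) = x" if "x \<in> hcar T" for x
      using swap.graph_unique[of "W x"] S[OF Wm[OF that]] W[OF that] by (simp add: sym)
    show "W (S y) = y" if "y \<in> hcar Y" for y
      by (rule graph_unique[OF W[OF Sm[OF that]] S[OF that]])
  qed (auto intro: Wm Sm)
  moreover have "W (a j) = b j" if "j \<in> J" for j
    by (rule graph_unique[OF W[OF a_mem[OF that]] graph_family[OF that]])
  ultimately show ?thesis by blast
qed

end

lemma covariant_rep_transport:
  assumes hT: "is_hmod sc st T" and hY: "is_hmod sc st Y" and cs: "cstar_alg sc st"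
    and W: "unitary_op T Y W" and cov: "covariant_rep sc st \<alpha> \<sigma> Y \<pi> u"
  shows "\<exists>\<pi>' u'. covariant_rep sc st \<alpha> \<sigma> T \<pi>' u' \<and>
    (\<forall>a. \<forall>t\<in>hcar T. W (\<pi>' a t) = \<pi> a (W t)) \<and> (\<forall>g. \<forall>t\<in>hcar T. W (u' g t) = u g (W t))"
proof -
  interpret T: hilbert_module sc st T by unfold_locales fact+
  interpret Y: hilbert_module sc st Y by unfold_locales fact+
  obtain S where Wm [simp]: "\<And>x. x \<in> hcar T \<Longrightarrow> W x \<in> hcar Y"
      and Sm [simp]: "\<And>y. y \<in> hcar Y \<Longrightarrow> S y \<in> hcar T"
      and adj: "\<And>x y. x \<in> hcar T \<Longrightarrow> y \<in> hcar Y \<Longrightarrow> hip Y (W x) y = hip T x (S y)"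
      and SW [simp]: "\<And>x. x \<in> hcar T \<Longrightarrow> S (W x) = x" and WS [simp]: "\<And>y. y \<in> hcar Y \<Longrightarrow> W (S y) = y"
    using W unfolding unitary_op_def by blast
  have adj': "hip T (S y) x = hip Y y (W x)" if "x \<in> hcar T" "y \<in> hcar Y" for x y
    using adj[of "S y" "W x"] that by simp
  \<comment> \<open>Linearity is not part of \<open>unitary_op\<close>; it is recovered by testing
    against all vectors of \<open>T\<close> and moving \<open>S\<close> across.\<close>
  have S_add: "S (y + y') = S y + S y'" if "y \<in> hcar Y" "y' \<in> hcar Y" for y y'
    by (rule T.ip_ext) (use that in \<open>simp_all add: T.ip_add_right Y.ip_add_right flip: adj\<close>)
  have S_hsc: "S (hsc Y c y) = hsc T c (S y)" if "y \<in> hcar Y" for c y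
    by (rule T.ip_ext) (use that in \<open>simp_all add: T.hip_hsc_right Y.hip_hsc_right flip: adj\<close>)
  have rep: "star_rep sc st Y \<pi>" and un: "\<And>g. unitary_op Y Y (u g)"
    and cov1: "\<And>g a y. y \<in> hcar Y \<Longrightarrow> u g (\<pi> a y) = \<pi> (\<alpha> g a) (u g y)"
    and cov2: "\<And>g h y. y \<in> hcar Y \<Longrightarrow> u g (u h y) = \<pi> (\<sigma> g h) (u (g + h) y)"
    using cov unfolding covariant_rep_def by auto
  have \<pi>m [simp]: "\<And>a y. y \<in> hcar Y \<Longrightarrow> \<pi> a y \<in> hcar Y"
    using rep unfolding star_rep_def by blast
  have um [simp]: "\<And>g y. y \<in> hcar Y \<Longrightarrow> u g y \<in> hcar Y"
    using un unfolding unitary_op_def by blast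
  define \<pi>' where "\<pi>' a t = S (\<pi> a (W t))" for a t
  define u' where "u' g t = S (u g (W t))" for g t
  have "star_rep sc st T \<pi>'"
    using rep unfolding star_rep_def \<pi>'_def
    by (auto simp: adj' S_add S_hsc simp flip: adj)
  moreover have "unitary_op T T (u' g)" for g
  proof -
    obtain V where V: "\<And>y. y \<in> hcar Y \<Longrightarrow> V y \<in> hcar Y"
        "\<And>x y. x \<in> hcar Y \<Longrightarrow> y \<in> hcar Y \<Longrightarrow> hip Y (u g x) y = hip Y x (V y)"
        "\<And>x. x \<in> hcar Y \<Longrightarrow> V (u g x) = x" "\<And>y. y \<in> hcar Y \<Longrightarrow> u g (V y) = y"
      using un[of g] unfolding unitary_op_def by blast
    show ?thesis
      unfolding unitary_op_def u'_def
      by (intro conjI exI[of _ "\<lambda>t. S (V (W t))"]) (auto simp: V adj' simp flip: adj)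
  qed
  ultimately have "covariant_rep sc st \<alpha> \<sigma> T \<pi>' u'"
    unfolding covariant_rep_def by (auto simp: \<pi>'_def u'_def cov1 cov2)
  then show ?thesis by (intro exI[of _ \<pi>'] exI[of _ u']) (auto simp: \<pi>'_def u'_def)
qed

section \<open>Equivariant representations\<close>

lemma bij_shift: "bij ((+) (g::'g::group_add))"
  by (rule bij_betw_byWitness[where f' = "(+) (- g)"]) (auto simp flip: add.assoc)

section \<open>Star-automorphisms\<close>

context cstar
begin

lemma star_aut_inv:
  assumes "star_aut sc st f"
  shows "star_aut sc st (inv f)"
proof -
  have f: "bij f" "f (a + b) = f a + f b" "f (sc c a) = sc c (f a)" "f (a * b) = f a * f b"
      "f (st a) = st (f a)" for a b c
    using assms unfolding star_aut_def by auto
  have fi: "f (inv f a) = a" for a using f(1) by (simp add: bij_is_surj surj_f_inv_f)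
  have eqI: "inv f a = b" if "a = f b" for a b using that f(1) by (simp add: bij_is_inj)
  show ?thesis
    unfolding star_aut_def
    by (intro conjI allI bij_imp_bij_inv f(1) eqI) (simp_all add: f fi)
qed

context
  fixes f assumes f: "star_aut sc st f"
begin

lemma star_aut_mult: "f (a * b) = f a * f b"
  and star_aut_add: "f (a + b) = f a + f b"
  and star_aut_sc: "f (sc c a) = sc c (f a)"
  and star_aut_st: "f (st a) = st (f a)"
  and star_aut_bij: "bij f"
  using f unfolding star_aut_def by auto

lemma star_aut_zero: "f 0 = 0"
  using star_aut_add[of 0 0] by simp

lemma star_aut_scaleR: "f (r *\<^sub>R a) = r *\<^sub>R f a"
  using star_aut_sc[of "complex_of_real r" a] by (simp add: sc_of_real)

lemma star_aut_diff: "f (a - b) = f a - f b"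
  using star_aut_add[of a "(-1) *\<^sub>R b"] star_aut_scaleR[of "-1" b] by simp

lemma star_aut_one: "f 1 = 1"
proof -
  obtain b where b: "f b = 1" using star_aut_bij by (metis bij_is_surj surjD)
  have "f 1 = f 1 * f b" by (simp add: b)
  also have "\<dots> = f (1 * b)" by (simp only: star_aut_mult)
  finally show ?thesis by (simp add: b)
qed

text \<open>The form \<open>st b * b\<close> is preserved by algebra alone, whereas the definition
  of the cone involves the norm, on which \<open>star_aut\<close> makes no statement.\<close>

lemma star_aut_pos_cone: "pos_cone a \<Longrightarrow> pos_cone (f a)"
  unfolding positive_el_iff_pos_cone[symmetric] positive_el_def
  by (metis star_aut_mult star_aut_st)

end

end

locale equivariant = hilbert_module sc st X
  for sc :: "complex \<Rightarrow> 'a::{real_normed_algebra_1,banach} \<Rightarrow> 'a" and st :: "'a \<Rightarrow> 'a"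
    and X :: "('x::ab_group_add, 'a) hmod" +
  fixes \<alpha> :: "'g::group_add \<Rightarrow> 'a \<Rightarrow> 'a" and \<sigma> :: "'g \<Rightarrow> 'g \<Rightarrow> 'a"
    and \<rho> :: "'a \<Rightarrow> 'x \<Rightarrow> 'x" and v :: "'g \<Rightarrow> 'x \<Rightarrow> 'x"
  assumes twisted: "twisted_system sc st \<alpha> \<sigma>"
    and equivariant: "equivariant_rep sc st \<alpha> \<sigma> X \<rho> v"
begin

abbreviation "\<alpha>i g \<equiv> inv (\<alpha> g)"
abbreviation "vi g \<equiv> inv_into (hcar X) (v g)"

lemma \<alpha>_aut: "star_aut sc st (\<alpha> g)"
  and \<sigma>_unitary: "st (\<sigma> g h) * \<sigma> g h = 1" "\<sigma> g h * st (\<sigma> g h) = 1"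
  and \<alpha>_\<alpha>: "\<alpha> g (\<alpha> h a) = \<sigma> g h * \<alpha> (g + h) a * st (\<sigma> g h)"
  and \<sigma>_cocycle: "\<sigma> g h * \<sigma> (g + h) k = \<alpha> g (\<sigma> h k) * \<sigma> g (h + k)"
  using twisted unfolding twisted_system_def unitary_el_def by blast+

lemma \<alpha>i_aut: "star_aut sc st (\<alpha>i g)"
  by (rule star_aut_inv[OF \<alpha>_aut])

lemmas \<alpha>_mult = star_aut_mult[OF \<alpha>_aut]
lemmas \<alpha>i_simps = star_aut_mult[OF \<alpha>i_aut] star_aut_add[OF \<alpha>i_aut] star_aut_sc[OF \<alpha>i_aut]
  star_aut_st[OF \<alpha>i_aut] star_aut_one[OF \<alpha>i_aut] star_aut_zero[OF \<alpha>i_aut]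

lemma \<alpha>_\<alpha>i [simp]: "\<alpha> g (\<alpha>i g a) = a"
  using star_aut_bij[OF \<alpha>_aut] by (simp add: bij_is_surj surj_f_inv_f)

lemma \<alpha>i_\<alpha> [simp]: "\<alpha>i g (\<alpha> g a) = a"
  using star_aut_bij[OF \<alpha>_aut] by (simp add: bij_is_inj)

lemma star_rep: "star_rep sc st X \<rho>"
  and v_inv: "bounded_invertible_map sc X (v g)"
  and \<rho>_\<alpha>: "x \<in> hcar X \<Longrightarrow> \<rho> (\<alpha> g a) x = v g (\<rho> a (vi g x))"
  and v_v: "x \<in> hcar X \<Longrightarrow> v g (v h x) = ad_rep X \<rho> st (\<sigma> g h) (v (g + h) x)"
  and hip_v: "x \<in> hcar X \<Longrightarrow> y \<in> hcar X \<Longrightarrow> hip X (v g x) (v g y) = \<alpha> g (hip X x y)"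
  and v_hact: "x \<in> hcar X \<Longrightarrow> v g (hact X x a) = hact X (v g x) (\<alpha> g a)"
  by (insert equivariant[unfolded equivariant_rep_def]; elim conjE; metis)+

lemma \<rho>_mem [simp]: "x \<in> hcar X \<Longrightarrow> \<rho> a x \<in> hcar X"
  and hip_\<rho>: "x \<in> hcar X \<Longrightarrow> y \<in> hcar X \<Longrightarrow> hip X (\<rho> a x) y = hip X x (\<rho> (st a) y)"
  and \<rho>_add: "x \<in> hcar X \<Longrightarrow> \<rho> (a + b) x = \<rho> a x + \<rho> b x"
  and \<rho>_sc: "x \<in> hcar X \<Longrightarrow> \<rho> (sc c a) x = hsc X c (\<rho> a x)"
  and \<rho>_mult: "x \<in> hcar X \<Longrightarrow> \<rho> (a * b) x = \<rho> a (\<rho> b x)"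
  and \<rho>_one [simp]: "x \<in> hcar X \<Longrightarrow> \<rho> 1 x = x"
  by (insert star_rep[unfolded star_rep_def]; elim conjE; meson)+

lemma v_bij: "bij_betw (v g) (hcar X) (hcar X)"
  using v_inv unfolding bounded_invertible_map_def by blast

lemma v_mem [simp]: "x \<in> hcar X \<Longrightarrow> v g x \<in> hcar X"
  using v_bij bij_betwE by blast

lemma vi_mem [simp]: "x \<in> hcar X \<Longrightarrow> vi g x \<in> hcar X"
  using v_bij by (metis bij_betw_def inv_into_into)

lemma v_vi [simp]: "x \<in> hcar X \<Longrightarrow> v g (vi g x) = x"
  using v_bij by (metis bij_betw_def f_inv_into_f)

lemma vi_v [simp]: "x \<in> hcar X \<Longrightarrow> vi g (v g x) = x"
  using v_bij by (metis bij_betw_def inv_into_f_f)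

lemma vi_eqI: "x \<in> hcar X \<Longrightarrow> y = v g x \<Longrightarrow> vi g y = x"
  by simp

lemma vi_zero [simp]: "vi g 0 = 0"
proof (rule vi_eqI)
  have "v g (0 + 0) = v g 0 + v g 0"
    using v_inv unfolding bounded_invertible_map_def by (metis zero_mem)
  then show "0 = v g 0" by simp
qed simp

lemma hip_vi: "x \<in> hcar X \<Longrightarrow> y \<in> hcar X \<Longrightarrow> hip X (vi g x) (vi g y) = \<alpha>i g (hip X x y)"
  using hip_v[of "vi g x" "vi g y" g] by (metis \<alpha>i_\<alpha> v_vi vi_mem)

lemma vi_\<rho>: "x \<in> hcar X \<Longrightarrow> vi g (\<rho> a x) = \<rho> (\<alpha>i g a) (vi g x)"
  using \<rho>_\<alpha>[of x g "\<alpha>i g a"] by simp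

text \<open>A map with an adjoint respects the module action: move it to the other side of the inner
  product, where the action factors out.\<close>

lemma \<rho>_hact: "x \<in> hcar X \<Longrightarrow> \<rho> a (hact X x b) = hact X (\<rho> a x) b"
proof (rule ip_ext)
  fix z assume "x \<in> hcar X" "z \<in> hcar X"
  then show "hip X z (\<rho> a (hact X x b)) = hip X z (hact X (\<rho> a x) b)"
    using hip_\<rho>[of z "hact X x b" "st a"] hip_\<rho>[of z x "st a"] by (simp add: ip_act_right)
qed auto

section \<open>The values prescribed on elementary tensors\<close>

definition w :: "'x \<Rightarrow> ('g \<Rightarrow> 'a) \<Rightarrow> 'g \<Rightarrow> 'x" where
  "w x \<xi> g = vi g (hact X x (\<xi> g))"

lemma hip_w:
  assumes "x \<in> hcar X" "y \<in> hcar X"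
  shows "hip X (w x \<xi> g) (w y \<eta> g) = \<alpha>i g (st (\<xi> g) * (hip X x y * \<eta> g))"
  using assms by (simp add: w_def hip_vi ip_act_left ip_act_right mult.assoc)

abbreviation "A\<Sigma> \<equiv> ASigma sc st \<alpha>"

lemma ASigma_mem: "\<xi> \<in> hcar A\<Sigma> \<longleftrightarrow> (\<lambda>g. \<alpha>i g (st (\<xi> g) * \<xi> g)) summable_on UNIV"
  by (simp add: ASigma_def)

text \<open>Conjugating \<open>norm ?c *\<^sub>R 1 - ?c\<close>, which is positive, by
  \<open>\<xi> g\<close> and applying \<open>\<alpha>i g\<close> bounds each term in the order by a
  fixed multiple of the corresponding term for \<open>\<xi>\<close>.\<close>

lemma w_mem:
  assumes x: "x \<in> hcar X" and \<xi>: "\<xi> \<in> hcar A\<Sigma>"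
  shows "w x \<xi> \<in> hcar (XG X)"
proof -
  let ?c = "hip X x x"
  have pc: "pos_cone ?c" using x by (rule ip_pos)
  have "(\<lambda>g. hip X (w x \<xi> g) (w x \<xi> g)) summable_on UNIV"
  proof (rule summable_on_pos_cone_comparison)
    show "(\<lambda>g. norm ?c *\<^sub>R \<alpha>i g (st (\<xi> g) * \<xi> g)) summable_on UNIV"
      using \<xi> by (intro summable_on_scaleR_right) (simp add: ASigma_mem)
    show "pos_cone (hip X (w x \<xi> g) (w x \<xi> g))" for g
      using x by (intro ip_pos) (simp add: w_def)
    show "pos_cone (norm ?c *\<^sub>R \<alpha>i g (st (\<xi> g) * \<xi> g) - hip X (w x \<xi> g) (w x \<xi> g))" for g
    proof -
      have "pos_cone (\<alpha>i g (st (\<xi> g) * (norm ?c *\<^sub>R 1 - ?c) * \<xi> g))"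
        using pc by (intro star_aut_pos_cone[OF \<alpha>i_aut] pos_cone_conj pos_cone_norm_diff
            pos_cone_selfadjoint)
      also have "st (\<xi> g) * (norm ?c *\<^sub>R 1 - ?c) * \<xi> g
          = norm ?c *\<^sub>R (st (\<xi> g) * \<xi> g) - st (\<xi> g) * (?c * \<xi> g)"
        by (simp add: algebra_simps)
      finally show ?thesis
        using x by (simp only: hip_w star_aut_diff[OF \<alpha>i_aut] star_aut_scaleR[OF \<alpha>i_aut])
    qed
  qed
  then show ?thesis using x by (simp add: w_def)
qed

lemma hip_XG_w:
  assumes "x \<in> hcar X" "y \<in> hcar X"
  shows "hip (XG X) (w x \<xi>) (w y \<eta>) = hip A\<Sigma> \<xi> (ellSigma (hip X x y) \<eta>)"
  using assms by (simp add: hip_w ASigma_def ellSigma_def)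

definition delta :: "'g \<Rightarrow> 'g \<Rightarrow> 'a" where
  "delta g h = (if h = g then 1 else 0)"

lemma delta_mem: "delta g \<in> hcar A\<Sigma>"
proof -
  have "(\<lambda>h. \<alpha>i h (st (delta g h) * delta g h)) summable_on UNIV \<longleftrightarrow>
        (\<lambda>h. \<alpha>i h (st (delta g h) * delta g h)) summable_on {g}"
    by (rule summable_on_cong_neutral) (auto simp: delta_def \<alpha>i_simps)
  then show ?thesis by (simp add: ASigma_mem)
qed

lemma w_v_delta: "x \<in> hcar X \<Longrightarrow> w (v g x) (delta g) h = (if h = g then x else 0)"
  by (simp add: w_def delta_def)

lemma sum_w_delta:
  assumes "\<And>g. \<xi> g \<in> hcar X" "finite F"
  shows "(\<Sum>g\<in>F. w (v g (\<xi> g)) (delta g)) h = (if h \<in> F then \<xi> h else 0)"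
proof -
  have "(\<Sum>g\<in>F. w (v g (\<xi> g)) (delta g)) h = (\<Sum>g\<in>F. w (v g (\<xi> g)) (delta g) h)"
    using assms(2) by (induction F) auto
  also have "\<dots> = (\<Sum>g\<in>F. if h = g then \<xi> g else 0)"
    using assms by (simp add: w_v_delta)
  also have "\<dots> = (if h \<in> F then \<xi> h else 0)" using assms(2) by simp
  finally show ?thesis .
qed

lemma w_dense:
  assumes \<xi>: "\<xi> \<in> hcar (XG X)" and e: "e > 0"
  obtains F where "finite F" "hnorm (XG X) (\<xi> - (\<Sum>g\<in>F. w (v g (\<xi> g)) (delta g))) < e"
proof -
  have \<xi>X: "\<xi> g \<in> hcar X" for g using \<xi> by simp
  have "(\<lambda>g. hip X (\<xi> g) (\<xi> g)) summable_on UNIV" using \<xi> by simp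
  \<comment> \<open>The square compensates for the root in the norm. Half of \<open>e\<close> is
    taken because bounds on partial sums reach the norm only as a non-strict inequality.\<close>
  moreover have "(e/2)\<^sup>2 > 0" using e by simp
  ultimately obtain F where F: "finite F"
      "\<forall>F'. finite F' \<and> F' \<subseteq> UNIV - F \<longrightarrow> norm (\<Sum>g\<in>F'. hip X (\<xi> g) (\<xi> g)) < (e/2)\<^sup>2"
    unfolding summable_on_iff_Cauchy by metis
  define r where "r = \<xi> - (\<Sum>g\<in>F. w (v g (\<xi> g)) (delta g))"
  have r: "r h = (if h \<in> F then 0 else \<xi> h)" for h
    using sum_w_delta[OF \<xi>X F(1)] by (simp add: r_def)
  interpret XG: hilbert_module sc st "XG X :: ('g \<Rightarrow> 'x, 'a) hmod"
    by unfold_locales (rule is_hmod_XG)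
  have rmem: "r \<in> hcar (XG X)"
    unfolding r_def using \<xi> \<xi>X by (intro XG.diff_mem XG.sum_mem w_mem delta_mem v_mem)
  have "hnorm (XG X) r \<le> e/2"
  proof (rule hnorm_XG_leI[OF rmem])
    fix F' :: "'g set" assume F': "finite F'"
    have "(\<Sum>g\<in>F'. hip X (r g) (r g)) = (\<Sum>g\<in>F' - F. hip X (\<xi> g) (\<xi> g))"
      using F' by (intro sum.mono_neutral_cong_right) (auto simp: r)
    moreover have "norm (\<Sum>g\<in>F' - F. hip X (\<xi> g) (\<xi> g)) < (e/2)\<^sup>2"
      by (rule F(2)[rule_format]) (use F' in auto)
    ultimately have "norm (\<Sum>g\<in>F'. hip X (r g) (r g)) \<le> (e/2)\<^sup>2" by simp
    then show "sqrt (norm (\<Sum>g\<in>F'. hip X (r g) (r g))) \<le> e/2"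
      using e by (intro real_le_lsqrt) auto
  qed (use e in simp)
  then show thesis using F(1) e by (intro that[of F]) (auto simp: r_def)
qed

text \<open>Translation only permutes the summands: by \<open>\<alpha>_\<alpha>\<close> the term at
  \<open>g + k\<close> equals the term of \<open>\<xi>\<close> at \<open>k\<close>, the unitary
  \<open>\<sigma> g k\<close> cancelling on both sides.\<close>

lemma lambdaSigma_mem:
  assumes "\<xi> \<in> hcar A\<Sigma>"
  shows "lambdaSigma \<alpha> \<sigma> g \<xi> \<in> hcar A\<Sigma>"
proof -
  let ?f = "\<lambda>k. \<alpha>i k (st (\<xi> k) * \<xi> k)"
  let ?l = "lambdaSigma \<alpha> \<sigma> g \<xi>"
  have "\<alpha>i h (st (?l h) * ?l h) = ?f (- g + h)" for h
  proof -
    define k where "k = - g + h"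
    have h: "h = g + k" by (simp add: k_def add.assoc[symmetric])
    let ?s = "\<sigma> g k"
    have "st (?l h) * ?l h = st ?s * \<alpha> g (st (\<xi> k) * \<xi> k) * ?s"
      by (simp add: lambdaSigma_def st_mult mult.assoc star_aut_st[OF \<alpha>_aut] \<alpha>_mult flip: k_def)
    also have "\<alpha> g (st (\<xi> k) * \<xi> k) = ?s * \<alpha> h (?f k) * st ?s"
      using \<alpha>_\<alpha>[of g k "?f k"] by (simp add: h)
    also have "st ?s * (?s * \<alpha> h (?f k) * st ?s) * ?s = (st ?s * ?s) * \<alpha> h (?f k) * (st ?s * ?s)"
      by (simp only: mult.assoc)
    finally show ?thesis by (simp add: \<sigma>_unitary k_def)
  qed
  moreover have "(\<lambda>h. ?f (- g + h)) summable_on UNIV \<longleftrightarrow> ?f summable_on UNIV"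
    by (rule summable_on_reindex_bij_betw) (rule bij_shift)
  ultimately show ?thesis using assms by (simp add: ASigma_mem)
qed

lemma reg_rho_w:
  assumes "x \<in> hcar X"
  shows "reg_rho \<alpha> \<rho> a (w x \<xi>) = w (\<rho> a x) \<xi>"
  using assms by (auto simp: reg_rho_def w_def vi_\<rho> simp flip: \<rho>_hact)

text \<open>The twist \<open>ad_rep\<close> in \<open>v g (v k z)\<close> multiplies by
  \<open>st (\<sigma> g k)\<close> on the right, and the factor \<open>\<sigma> g k\<close> in
  \<open>lambdaSigma\<close> cancels exactly this. What survives is
  \<open>\<rho> (\<sigma> g k)\<close> on the left, which \<open>vi h\<close> turns into the
  \<open>\<rho> (\<alpha>i h (\<sigma> g k))\<close> of \<open>reg_lambda\<close>.\<close>

lemma reg_lambda_w: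
  assumes x: "x \<in> hcar X"
  shows "reg_lambda \<alpha> \<sigma> \<rho> g (w x \<xi>) = w (v g x) (lambdaSigma \<alpha> \<sigma> g \<xi>)"
proof
  fix h
  define k where "k = - g + h"
  have h: "h = g + k" by (simp add: k_def add.assoc[symmetric])
  let ?s = "\<sigma> g k" and ?z = "vi k (hact X x (\<xi> k))"
  have z: "?z \<in> hcar X" using x by simp
  have "hact X (v g x) (\<alpha> g (\<xi> k) * ?s) = hact X (v g (hact X x (\<xi> k))) ?s"
    using x by (simp add: hact_mult v_hact)
  also have "v g (hact X x (\<xi> k)) = v g (v k ?z)" using x by simp
  also have "\<dots> = hact X (\<rho> ?s (v h ?z)) (st ?s)"
    unfolding v_v[OF z] ad_rep_def h ..
  also have "hact X (hact X (\<rho> ?s (v h ?z)) (st ?s)) ?s = \<rho> ?s (v h ?z)"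
    using z by (simp add: \<sigma>_unitary flip: hact_mult)
  finally have "vi h (hact X (v g x) (\<alpha> g (\<xi> k) * ?s)) = \<rho> (\<alpha>i h ?s) ?z"
    using z by (simp add: vi_\<rho>)
  then show "reg_lambda \<alpha> \<sigma> \<rho> g (w x \<xi>) h = w (v g x) (lambdaSigma \<alpha> \<sigma> g \<xi>) h"
    by (simp add: reg_lambda_def w_def lambdaSigma_def flip: k_def)
qed

section \<open>The regular covariant representation\<close>

lemma \<rho>_contractive:
  assumes x: "x \<in> hcar X" and bc: "st b * b + st c * c = r *\<^sub>R 1"
  shows "pos_cone (r *\<^sub>R hip X x x - hip X (\<rho> b x) (\<rho> b x))"
proof -
  have "r *\<^sub>R hip X x x = hip X x (\<rho> (r *\<^sub>R 1) x)"
    using x \<rho>_sc[OF x, of "complex_of_real r" 1]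
    by (simp add: sc_of_real hip_hsc_right)
  \<comment> \<open>The difference is thus the inner product of \<open>\<rho> c x\<close> with
    itself: \<open>c\<close> witnesses that \<open>st b * b\<close> is at most
    \<open>r\<close>.\<close>
  also have "\<dots> = hip X (\<rho> b x) (\<rho> b x) + hip X (\<rho> c x) (\<rho> c x)"
    using x by (simp add: \<rho>_add \<rho>_mult ip_add_right hip_\<rho> flip: bc)
  finally show ?thesis using x by (simp add: ip_pos)
qed

lemma hip_\<rho>_unitary:
  assumes "x \<in> hcar X" "st u * u = 1"
  shows "hip X (\<rho> u x) (\<rho> u x) = hip X x x"
  using assms by (simp add: hip_\<rho> flip: \<rho>_mult)

lemma reg_rho_mem:
  assumes \<xi>: "\<xi> \<in> hcar (XG X)"
  shows "reg_rho \<alpha> \<rho> a \<xi> \<in> hcar (XG X)"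
proof -
  let ?r = "norm (st a * a)"
  have "pos_cone (?r *\<^sub>R 1 - st a * a)" by (rule pos_cone_norm_diff) (simp add: st_mult)
  then obtain c where "?r *\<^sub>R 1 - st a * a = st c * c"
    unfolding positive_el_iff_pos_cone[symmetric] positive_el_def by blast
  then have c: "st a * a + st c * c = ?r *\<^sub>R 1" by (simp add: algebra_simps)
  \<comment> \<open>An automorphism carries the witness along and fixes multiples of 1, so one
    constant serves at every point \<open>h\<close>, as the comparison requires.\<close>
  have c': "st (\<alpha>i h a) * \<alpha>i h a + st (\<alpha>i h c) * \<alpha>i h c = ?r *\<^sub>R 1" for h
    using arg_cong[OF c, of "\<alpha>i h"] by (simp add: \<alpha>i_simps star_aut_scaleR[OF \<alpha>i_aut])
  have "(\<lambda>h. hip X (reg_rho \<alpha> \<rho> a \<xi> h) (reg_rho \<alpha> \<rho> a \<xi> h)) summable_on UNIV"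
  proof (rule summable_on_pos_cone_comparison)
    show "(\<lambda>h. ?r *\<^sub>R hip X (\<xi> h) (\<xi> h)) summable_on UNIV"
      using \<xi> by (intro summable_on_scaleR_right) simp
  qed (use \<xi> c' in \<open>auto simp: reg_rho_def intro!: ip_pos \<rho>_contractive\<close>)
  then show ?thesis using \<xi> by (simp add: reg_rho_def)
qed

lemma star_rep_reg_rho: "star_rep sc st (XG X) (reg_rho \<alpha> \<rho>)"
  unfolding star_rep_def
proof (intro conjI allI ballI)
  fix a and \<xi> \<eta> :: "'g \<Rightarrow> 'x" assume "\<xi> \<in> hcar (XG X)" "\<eta> \<in> hcar (XG X)"
  then show "hip (XG X) (reg_rho \<alpha> \<rho> a \<xi>) \<eta> = hip (XG X) \<xi> (reg_rho \<alpha> \<rho> (st a) \<eta>)"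
    by (simp add: reg_rho_def hip_\<rho> \<alpha>i_simps)
  show "reg_rho \<alpha> \<rho> a \<xi> \<in> hcar (XG X)" by (rule reg_rho_mem) fact
qed (auto simp: reg_rho_def \<alpha>i_simps \<rho>_add \<rho>_sc \<rho>_mult)

lemma reg_lambda_unitary: "unitary_op (XG X) (XG X) (reg_lambda \<alpha> \<sigma> \<rho> g)"
proof -
  \<comment> \<open>Found by solving
    \<open>reg_lambda \<alpha> \<sigma> \<rho> g \<xi> = \<eta>\<close> for \<open>\<xi>\<close> at
    the point \<open>h = g + k\<close>; the unitary is inverted by its adjoint.\<close>
  define L where "L \<eta> k = \<rho> (\<alpha>i (g + k) (st (\<sigma> g k))) (\<eta> (g + k))" for \<eta> :: "'g \<Rightarrow> 'x" and k
  have u: "st (\<alpha>i h (\<sigma> g k)) * \<alpha>i h (\<sigma> g k) = 1" "\<alpha>i h (\<sigma> g k) * st (\<alpha>i h (\<sigma> g k)) = 1" for h k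
    by (simp_all add: \<sigma>_unitary \<alpha>i_simps(5) flip: \<alpha>i_simps(1,4))
  have reindex: "((\<lambda>h. f (- g + h)) summable_on UNIV) = (f summable_on UNIV)"
      "((\<lambda>h. f (g + h)) summable_on UNIV) = (f summable_on UNIV)" for f :: "'g \<Rightarrow> 'a"
    by (rule summable_on_reindex_bij_betw, rule bij_shift)+
  have mem: "reg_lambda \<alpha> \<sigma> \<rho> g \<xi> \<in> hcar (XG X)" if "\<xi> \<in> hcar (XG X)" for \<xi>
    using that reindex(1)[of "\<lambda>h. hip X (\<xi> h) (\<xi> h)"]
    by (simp add: reg_lambda_def hip_\<rho>_unitary u)
  have memL: "L \<eta> \<in> hcar (XG X)" if "\<eta> \<in> hcar (XG X)" for \<eta>
    using that reindex(2)[of "\<lambda>h. hip X (\<eta> h) (\<eta> h)"]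
    by (simp add: L_def hip_\<rho>_unitary u \<alpha>i_simps(4))
  have adj: "hip (XG X) (reg_lambda \<alpha> \<sigma> \<rho> g \<xi>) \<eta> = hip (XG X) \<xi> (L \<eta>)"
    if "\<xi> \<in> hcar (XG X)" "\<eta> \<in> hcar (XG X)" for \<xi> \<eta>
  proof -
    have "hip (XG X) (reg_lambda \<alpha> \<sigma> \<rho> g \<xi>) \<eta>
        = (\<Sum>\<^sub>\<infinity>h. hip X (\<xi> (- g + h)) (\<rho> (\<alpha>i h (st (\<sigma> g (- g + h)))) (\<eta> h)))"
      using that by (simp add: reg_lambda_def hip_\<rho> \<alpha>i_simps(4))
    also have "\<dots> = (\<Sum>\<^sub>\<infinity>k. hip X (\<xi> (- g + (g + k))) (\<rho> (\<alpha>i (g + k) (st (\<sigma> g (- g + (g + k))))) (\<eta> (g + k))))"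
      by (rule infsum_reindex_bij_betw[OF bij_shift, symmetric])
    finally show ?thesis by (simp add: L_def flip: add.assoc)
  qed
  have "L (reg_lambda \<alpha> \<sigma> \<rho> g \<xi>) = \<xi>" if "\<xi> \<in> hcar (XG X)" for \<xi>
    using that u by (intro ext) (simp add: L_def reg_lambda_def \<alpha>i_simps(4) flip: add.assoc \<rho>_mult)
  moreover have "reg_lambda \<alpha> \<sigma> \<rho> g (L \<eta>) = \<eta>" if "\<eta> \<in> hcar (XG X)" for \<eta>
    using that u by (intro ext) (simp add: L_def reg_lambda_def \<alpha>i_simps(4) flip: add.assoc \<rho>_mult)
  ultimately show ?thesis
    unfolding unitary_op_def using mem memL adj by (intro conjI exI[of _ L]) blast+
qed

text \<open>At each point both sides are \<open>\<rho>\<close> of some algebra element applied to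
  the same value of \<open>\<xi>\<close>. So each relation reduces to an identity in the algebra,
  the second one to the cocycle equation.\<close>

lemma covariant_rep_XG: "covariant_rep sc st \<alpha> \<sigma> (XG X) (reg_rho \<alpha> \<rho>) (reg_lambda \<alpha> \<sigma> \<rho>)"
  unfolding covariant_rep_def
proof (intro conjI allI ballI star_rep_reg_rho reg_lambda_unitary ext)
  \<comment> \<open>The twisted composition law pulled back by \<open>\<alpha>i (g + k)\<close>. It
    serves covariance with \<open>b = a\<close> and the product of translations with
    \<open>b = \<sigma> h k\<close>.\<close>
  have swap: "\<alpha>i (g + k) (\<sigma> g k) * \<alpha>i k b = \<alpha>i (g + k) (\<alpha> g b * \<sigma> g k)" for g k b
  proof -
    have "\<alpha> g b * \<sigma> g k = \<sigma> g k * \<alpha> (g + k) (\<alpha>i k b) * (st (\<sigma> g k) * \<sigma> g k)"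
      using \<alpha>_\<alpha>[of g k "\<alpha>i k b"] by (simp add: mult.assoc)
    then show ?thesis by (simp add: \<sigma>_unitary \<alpha>i_simps(1))
  qed
  fix g :: 'g and \<xi> :: "'g \<Rightarrow> 'x" and p assume \<xi>: "\<xi> \<in> hcar (XG X)"
  have \<xi>X: "\<xi> k \<in> hcar X" for k using \<xi> by simp
  define q where "q = - g + p"
  have p: "p = g + q" by (simp add: q_def add.assoc[symmetric])
  show "reg_lambda \<alpha> \<sigma> \<rho> g (reg_rho \<alpha> \<rho> a \<xi>) p = reg_rho \<alpha> \<rho> (\<alpha> g a) (reg_lambda \<alpha> \<sigma> \<rho> g \<xi>) p" for a
    using \<xi>X swap[of g q a]
    by (simp add: reg_lambda_def reg_rho_def \<alpha>i_simps(1) p flip: \<rho>_mult add.assoc)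
  show "reg_lambda \<alpha> \<sigma> \<rho> g (reg_lambda \<alpha> \<sigma> \<rho> h \<xi>) p
      = reg_rho \<alpha> \<rho> (\<sigma> g h) (reg_lambda \<alpha> \<sigma> \<rho> (g + h) \<xi>) p" for h
  proof -
    define k where "k = - h + q"
    have q: "q = h + k" by (simp add: k_def add.assoc[symmetric])
    have k: "- (g + h) + p = k" by (simp add: k_def p minus_add flip: add.assoc)
    have "\<alpha>i p (\<sigma> g q) * \<alpha>i q (\<sigma> h k) = \<alpha>i p (\<alpha> g (\<sigma> h k) * \<sigma> g q)"
      using swap[of g q "\<sigma> h k"] by (simp add: p)
    also have "\<dots> = \<alpha>i p (\<sigma> g h * \<sigma> (g + h) k)" by (simp add: \<sigma>_cocycle q)
    finally have "\<alpha>i p (\<sigma> g q) * \<alpha>i q (\<sigma> h k) = \<alpha>i p (\<sigma> g h) * \<alpha>i p (\<sigma> (g + h) k)"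
      by (simp add: \<alpha>i_simps(1))
    then show ?thesis
      unfolding reg_lambda_def reg_rho_def k q_def[symmetric] k_def[symmetric]
      using \<xi>X by (simp flip: \<rho>_mult)
  qed
qed

end

section \<open>The unitary \<open>W\<close> and the representation on the tensor product\<close>

theorem theorem4p10:
  fixes sc :: "complex \<Rightarrow> 'a::{real_normed_algebra_1,banach} \<Rightarrow> 'a"
    and st :: "'a \<Rightarrow> 'a"
    and \<alpha> :: "'g::group_add \<Rightarrow> 'a \<Rightarrow> 'a"
    and \<sigma> :: "'g \<Rightarrow> 'g \<Rightarrow> 'a"
    and X :: "('x::ab_group_add, 'a) hmod"
    and \<rho> :: "'a \<Rightarrow> 'x \<Rightarrow> 'x"
    and v :: "'g \<Rightarrow> 'x \<Rightarrow> 'x"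
    and T :: "('t::ab_group_add, 'a) hmod"
    and tens :: "'x \<Rightarrow> ('g \<Rightarrow> 'a) \<Rightarrow> 't"
  assumes sys: "twisted_system sc st \<alpha> \<sigma>"
    and hX: "is_hmod sc st X"
    and eqv: "equivariant_rep sc st \<alpha> \<sigma> X \<rho> v"
    and tensor: "internal_tensor sc st \<alpha> X T tens"
  shows "\<exists>W. unitary_op T (XG X) W \<and>
    (\<forall>x\<in>hcar X. \<forall>\<xi>\<in>hcar (ASigma sc st \<alpha>). \<forall>g.
        W (tens x \<xi>) g = inv_into (hcar X) (v g) (hact X x (\<xi> g))) \<and>
    (\<forall>a. \<forall>x\<in>hcar X. \<forall>\<xi>\<in>hcar (ASigma sc st \<alpha>).
        reg_rho \<alpha> \<rho> a (W (tens x \<xi>)) = W (tens (\<rho> a x) \<xi>)) \<and>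
    (\<forall>g. \<forall>x\<in>hcar X. \<forall>\<xi>\<in>hcar (ASigma sc st \<alpha>).
        reg_lambda \<alpha> \<sigma> \<rho> g (W (tens x \<xi>)) = W (tens (v g x) (lambdaSigma \<alpha> \<sigma> g \<xi>))) \<and>
    (\<exists>rhoT lamT. covariant_rep sc st \<alpha> \<sigma> T rhoT lamT \<and>
        (\<forall>a. \<forall>x\<in>hcar X. \<forall>\<xi>\<in>hcar (ASigma sc st \<alpha>). rhoT a (tens x \<xi>) = tens (\<rho> a x) \<xi>) \<and>
        (\<forall>g. \<forall>x\<in>hcar X. \<forall>\<xi>\<in>hcar (ASigma sc st \<alpha>).
            lamT g (tens x \<xi>) = tens (v g x) (lambdaSigma \<alpha> \<sigma> g \<xi>)) \<and>
        (\<forall>a. \<forall>t\<in>hcar T. W (rhoT a t) = reg_rho \<alpha> \<rho> a (W t)) \<and>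
        (\<forall>g. \<forall>t\<in>hcar T. W (lamT g t) = reg_lambda \<alpha> \<sigma> \<rho> g (W t)))"
proof -
  have cs: "cstar_alg sc st" using sys unfolding twisted_system_def by blast
  interpret equivariant sc st X \<alpha> \<sigma> \<rho> v by unfold_locales fact+
  have hT: "is_hmod sc st T"
    and tens_mem: "\<And>x \<xi>. x \<in> hcar X \<Longrightarrow> \<xi> \<in> hcar A\<Sigma> \<Longrightarrow> tens x \<xi> \<in> hcar T"
    and tens_hip: "\<And>x \<xi> y \<eta>. x \<in> hcar X \<Longrightarrow> \<xi> \<in> hcar A\<Sigma> \<Longrightarrow> y \<in> hcar X \<Longrightarrow> \<eta> \<in> hcar A\<Sigma> \<Longrightarrow>
        hip T (tens x \<xi>) (tens y \<eta>) = hip A\<Sigma> \<xi> (ellSigma (hip X x y) \<eta>)"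
    and tens_dense: "\<And>t e. t \<in> hcar T \<Longrightarrow> e > 0 \<Longrightarrow> \<exists>I xs \<xi>s. finite (I::nat set) \<and>
        xs ` I \<subseteq> hcar X \<and> \<xi>s ` I \<subseteq> hcar A\<Sigma> \<and> hnorm T (t - (\<Sum>i\<in>I. tens (xs i) (\<xi>s i))) < e"
    by (insert tensor[unfolded internal_tensor_def]; elim conjE; simp)+
  have hXG: "is_hmod sc st (XG X :: ('g \<Rightarrow> 'x, 'a) hmod)" by (rule is_hmod_XG)
  interpret isometric_families sc st T "XG X :: ('g \<Rightarrow> 'x, 'a) hmod" "hcar X \<times> hcar A\<Sigma>"
    "\<lambda>(x, \<xi>). tens x \<xi>" "\<lambda>(x, \<xi>). w x \<xi>"
  proof unfold_locales
    fix t and e :: real assume "t \<in> hcar T" "e > 0"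
    then obtain I :: "nat set" and xs \<xi>s where I: "finite I"
        "xs ` I \<subseteq> hcar X" "\<xi>s ` I \<subseteq> hcar A\<Sigma>" "hnorm T (t - (\<Sum>i\<in>I. tens (xs i) (\<xi>s i))) < e"
      using tens_dense by metis
    then show "\<exists>I k. finite (I::nat set) \<and> k ` I \<subseteq> hcar X \<times> hcar A\<Sigma> \<and>
        hnorm T (t - (\<Sum>i\<in>I. case k i of (x, \<xi>) \<Rightarrow> tens x \<xi>)) < e"
      by (intro exI[of _ I] exI[of _ "\<lambda>i. (xs i, \<xi>s i)"]) auto
  next
    fix \<zeta> :: "'g \<Rightarrow> 'x" and e :: real assume \<zeta>: "\<zeta> \<in> hcar (XG X)" and "e > 0"
    then obtain F where F: "finite F"
        "hnorm (XG X) (\<zeta> - (\<Sum>g\<in>F. w (v g (\<zeta> g)) (delta g))) < e"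
      by (rule w_dense)
    \<comment> \<open>Approximating sums are indexed by natural numbers, so the finite set F of
      group elements has to be enumerated.\<close>
    obtain p where p: "bij_betw p {0..<card F} F" using F(1) ex_bij_betw_nat_finite by blast
    let ?k = "\<lambda>i. (v (p i) (\<zeta> (p i)), delta (p i))"
    have "(\<Sum>g\<in>F. w (v g (\<zeta> g)) (delta g)) = (\<Sum>i\<in>{0..<card F}. case ?k i of (x, \<xi>) \<Rightarrow> w x \<xi>)"
      by (simp add: sum.reindex_bij_betw[OF p, of "\<lambda>g. w (v g (\<zeta> g)) (delta g)"])
    then show "\<exists>I k. finite (I::nat set) \<and> k ` I \<subseteq> hcar X \<times> hcar A\<Sigma> \<and>
        hnorm (XG X) (\<zeta> - (\<Sum>i\<in>I. case k i of (x, \<xi>) \<Rightarrow> w x \<xi>)) < e"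
      using F(2) \<zeta> by (intro exI[of _ "{0..<card F}"] exI[of _ ?k]) (auto simp: delta_mem)
  qed (use hT hXG in \<open>auto simp: tens_hip hip_XG_w simp del: XG_simps intro!: tens_mem w_mem\<close>)
  obtain W where W: "unitary_op T (XG X) W"
    and W_tens: "\<And>x \<xi>. x \<in> hcar X \<Longrightarrow> \<xi> \<in> hcar A\<Sigma> \<Longrightarrow> W (tens x \<xi>) = w x \<xi>"
    using unitary_extension by auto
  obtain rhoT lamT where cov: "covariant_rep sc st \<alpha> \<sigma> T rhoT lamT"
    and W_rho: "\<And>a t. t \<in> hcar T \<Longrightarrow> W (rhoT a t) = reg_rho \<alpha> \<rho> a (W t)"
    and W_lam: "\<And>g t. t \<in> hcar T \<Longrightarrow> W (lamT g t) = reg_lambda \<alpha> \<sigma> \<rho> g (W t)"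
    using covariant_rep_transport[OF hT hXG cs W covariant_rep_XG] by blast
  \<comment> \<open>The formulas on elementary tensors hold after applying \<open>W\<close>, by the
    intertwining relations; injectivity brings them back to \<open>T\<close>.\<close>
  have W_inj: "t = t'" if "t \<in> hcar T" "t' \<in> hcar T" "W t = W t'" for t t'
    using W that unfolding unitary_op_def by metis
  have rhoT_mem: "rhoT a t \<in> hcar T" and lamT_mem: "lamT g t \<in> hcar T" if "t \<in> hcar T" for a g t
    using cov that unfolding covariant_rep_def star_rep_def unitary_op_def by simp_all
  have rho_eq: "reg_rho \<alpha> \<rho> a (W (tens x \<xi>)) = W (tens (\<rho> a x) \<xi>)"
    if "x \<in> hcar X" "\<xi> \<in> hcar A\<Sigma>" for a x \<xi>
    using that by (simp add: W_tens reg_rho_w)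
  have lam_eq: "reg_lambda \<alpha> \<sigma> \<rho> g (W (tens x \<xi>)) = W (tens (v g x) (lambdaSigma \<alpha> \<sigma> g \<xi>))"
    if "x \<in> hcar X" "\<xi> \<in> hcar A\<Sigma>" for g x \<xi>
    using that by (simp add: W_tens reg_lambda_w lambdaSigma_mem)
  have "rhoT a (tens x \<xi>) = tens (\<rho> a x) \<xi>" if "x \<in> hcar X" "\<xi> \<in> hcar A\<Sigma>" for a x \<xi>
    by (rule W_inj) (use that in \<open>simp_all add: rhoT_mem tens_mem W_rho rho_eq\<close>)
  moreover have "lamT g (tens x \<xi>) = tens (v g x) (lambdaSigma \<alpha> \<sigma> g \<xi>)"
    if "x \<in> hcar X" "\<xi> \<in> hcar A\<Sigma>" for g x \<xi>
    by (rule W_inj) (use that in \<open>simp_all add: lamT_mem tens_mem W_lam lam_eq lambdaSigma_mem\<close>)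
  moreover have "W (tens x \<xi>) g = vi g (hact X x (\<xi> g))" if "x \<in> hcar X" "\<xi> \<in> hcar A\<Sigma>" for x \<xi> g
    using that by (simp add: W_tens w_def)
  ultimately show ?thesis
    using W cov W_rho W_lam rho_eq lam_eq
    by (intro exI[of _ W] conjI exI[of _ rhoT] exI[of _ lamT]) blast+
qed

end
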